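(* Let $P$ be a Gorenstein polytope of index $r$. Let $F$ be a face of $P$ (possibly $\emptyset$ or $P$) and let $F^{*}$ be the face of the dual Gorenstein polytope $P^{\times}$ corresponding to $F$. Then \[ r \leq \operatorname{codeg} F + \operatorname{codeg} F^{*}. \]
   Context: Let $M\cong\mathbb{Z}^d$ be a lattice with dual lattice $N$ and natural pairing $\langle\cdot,\cdot\rangle$. A lattice polytope is the convex hull of finitely many lattice points; $\emptyset$ is a lattice polytope of dimension $-1$, and faces of a polytope include $\emptyset$ and the polytope itself. Every face is regarded as a lattice polytope with respect to the lattice points of its own affine hull. For a lattice polytope $Q$ of dimension $e\ge0$, the polynomial $h^*_Q(t)$ is defined by $1+\sum_{k\ge1}\#(kQ\cap\text{lattice})\,t^k=h^*_Q(t)/(1-t)^{e+1}$. One sets $\deg Q:=\deg h^*_Q$ and $\operatorname{codeg}Q:=e+1-\deg Q$; equivalently, $\operatorname{codeg}Q$ is the smallest positive integer $k$ such that $kQ$ has a lattice point in its relative interior. By convention $h^*_\emptyset=1$ and $\deg\emptyset=\operatorname{codeg}\emptyset=0$. A full-dimensional lattice polytope $Q\subset M_\mathbb{R}$ is reflexive if $0$ lies in its interior and $0$ has integral distance $1$ to the supporting hyperplane of every facet. A $d$-dimensional lattice polytope $P\subset M_\mathbb{R}$ is Gorenstein of index $r\in\mathbb{Z}_{>0}$ if $rP$ contains a unique interior lattice point $m$ and $rP-m$ is reflexive. In that case $r=\operatorname{codeg}P$. Dual Gorenstein polytope: let $C_P\subset(M\oplus\mathbb{Z})_\mathbb{R}$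 be the cone generated by $P\times\{1\}$, and let $C_P^\vee\subset(N\oplus\mathbb{Z})_\mathbb{R}$ be its dual cone. Then $C_P^\vee$ is generated by the lattice points in the hyperplane $\{y:\langle y,(m,r)\rangle=1\}$. The dual Gorenstein polytope is \[ P^\times:=\{y\in C_P^\vee:\langle y,(m,r)\rangle=1\}, \] a Gorenstein polytope of index $r$ with respect to the lattice $N\oplus\mathbb{Z}$ restricted to its affine hull. Duality of faces: for a face $F$ of $P$, set $F^*:=\{y\in P^\times:\langle y,(x,1)\rangle=0\ \text{for all }x\in F\}$. This gives an inclusion-reversing bijection between the faces of $P$ and those of $P^\times$, with $\dim F+\dim F^*=d-1$, $\emptyset^*=P^\times$ and $P^*=\emptyset$. *)

theory Defs
  imports
    "HOL-Analysis.Analysis"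
    "HOL-Computational_Algebra.Computational_Algebra"
begin

text \<open>
  A lattice of rank \<open>d\<close> is the \<open>\<int>\<close>-span \<open>L\<close> of \<open>d\<close> linearly independent vectors of a Euclidean
  space, and its real vector space is \<^term>\<open>span L\<close>, which need not be the whole space
  (in particular rank 0 is allowed). The inner product restricted to \<^term>\<open>span L\<close>
  serves as the pairing, so that the dual lattice lies in \<^term>\<open>span L\<close> as well.
\<close>

definition zlattice :: "'a::euclidean_space set \<Rightarrow> bool" where
  "zlattice L \<longleftrightarrow> (\<exists>B. independent B \<and> L = group_closure B)"

definition dual_lattice :: "'a::euclidean_space set \<Rightarrow> 'a set" where
  "dual_lattice L = {y \<in> span L. \<forall>x\<in>L. y \<bullet> x \<in> \<int>}"

definition primitive_in :: "'a::euclidean_space set \<Rightarrow> 'a \<Rightarrow> bool" where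
  "primitive_in L u \<longleftrightarrow>
     u \<in> L \<and> u \<noteq> 0 \<and> (\<forall>k::nat. k > 0 \<longrightarrow> (1 / real k) *\<^sub>R u \<in> L \<longrightarrow> k = 1)"

definition lattice_polytope :: "'a::euclidean_space set \<Rightarrow> 'a set \<Rightarrow> bool" where
  "lattice_polytope L Q \<longleftrightarrow> (\<exists>V. finite V \<and> V \<subseteq> L \<and> Q = convex hull V)"

definition dilate :: "nat \<Rightarrow> 'a::euclidean_space set \<Rightarrow> 'a set" where
  "dilate k Q = (\<lambda>x. real k *\<^sub>R x) ` Q"

text \<open>
  The argument \<open>L\<close> below is the ambient lattice, also when \<open>Q\<close> is not full-dimensional.
  If \<open>v \<in> L\<close> lies in the affine hull of \<open>Q\<close>, then translation by \<open>k v\<close> identifies the points of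
  \<open>L\<close> in \<open>k Q\<close> with the points of \<open>k (Q - v)\<close> in the lattice \<open>(L \<inter> aff Q) - v\<close>; so the counts are
  those with respect to the lattice points of the affine hull of \<open>Q\<close>.
\<close>

definition ehrhart_series :: "'a::euclidean_space set \<Rightarrow> 'a set \<Rightarrow> real fps" where
  "ehrhart_series L Q = Abs_fps (\<lambda>k. if k = 0 then 1 else real (card (dilate k Q \<inter> L)))"

text \<open>
  Since \<^term>\<open>aff_dim {} = -1\<close>, the formulas for \<open>hstar\<close> and \<open>codeg\<close> also give the
  conventional values for the empty polytope; see \<open>hstar_empty\<close> and \<open>codeg_empty\<close>.
\<close>

definition hstar :: "'a::euclidean_space set \<Rightarrow> 'a set \<Rightarrow> real poly" where
  "hstar L Q =
     (THE h. ehrhart_series L Q = fps_of_poly h / (1 - fps_X) ^ nat (aff_dim Q + 1))"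

definition codeg :: "'a::euclidean_space set \<Rightarrow> 'a set \<Rightarrow> int" where
  "codeg L Q = aff_dim Q + 1 - int (degree (hstar L Q))"

text \<open>
  A relation rather than a function: \<open>\<delta>\<close> is the integral distance of \<open>x\<close> from the hyperplane \<open>H\<close>
  of \<^term>\<open>span L\<close>.
\<close>

definition integral_distance :: "'a::euclidean_space set \<Rightarrow> 'a \<Rightarrow> 'a set \<Rightarrow> real \<Rightarrow> bool" where
  "integral_distance L x H \<delta> \<longleftrightarrow>
     (\<exists>u c. primitive_in (dual_lattice L) u \<and> H = {y \<in> span L. u \<bullet> y = c} \<and> \<delta> = \<bar>u \<bullet> x - c\<bar>)"

text \<open>
  For a full-dimensional polytope, \<^const>\<open>rel_interior\<close> is the interior inside \<^term>\<open>span L\<close>,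
  and the affine hull of a facet is its supporting hyperplane.
\<close>

definition reflexive_polytope :: "'a::euclidean_space set \<Rightarrow> 'a set \<Rightarrow> bool" where
  "reflexive_polytope L Q \<longleftrightarrow>
     lattice_polytope L Q \<and> aff_dim Q = int (dim L) \<and> 0 \<in> rel_interior Q \<and>
     (\<forall>F. F facet_of Q \<longrightarrow> integral_distance L 0 (affine hull F) 1)"

text \<open>
  In rank 0 a point has no facets, so every \<open>r > 0\<close> would satisfy the other conditions;
  the clause for \<^term>\<open>dim L = 0\<close> retains only \<open>r = 1\<close>, the codegree of a point.
  For positive rank the clause is vacuous.
\<close>

definition gorenstein :: "'a::euclidean_space set \<Rightarrow> nat \<Rightarrow> 'a set \<Rightarrow> bool" where
  "gorenstein L r P \<longleftrightarrow>
     lattice_polytope L P \<and> aff_dim P = int (dim L) \<and> r > 0 \<and> (dim L = 0 \<longrightarrow> r = 1) \<and>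
     (\<exists>m. rel_interior (dilate r P) \<inter> L = {m} \<and>
          reflexive_polytope L ((\<lambda>x. x - m) ` dilate r P))"

definition gorenstein_point :: "'a::euclidean_space set \<Rightarrow> nat \<Rightarrow> 'a set \<Rightarrow> 'a" where
  "gorenstein_point L r P = (THE m. rel_interior (dilate r P) \<inter> L = {m})"

definition cone_over :: "'a::euclidean_space set \<Rightarrow> ('a \<times> real) set" where
  "cone_over P = convex_cone hull (P \<times> {1})"

text \<open>The lattice \<open>N \<oplus> \<int>\<close> for \<open>N\<close> the dual of \<open>L\<close>.\<close>

definition dual_lattice_ext :: "'a::euclidean_space set \<Rightarrow> ('a \<times> real) set" where
  "dual_lattice_ext L = dual_lattice L \<times> \<int>"

definition dual_cone :: "'a::euclidean_space set \<Rightarrow> 'a set \<Rightarrow> ('a \<times> real) set" where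
  "dual_cone L P = {y \<in> span (dual_lattice_ext L). \<forall>x\<in>cone_over P. 0 \<le> y \<bullet> x}"

definition dual_gorenstein :: "'a::euclidean_space set \<Rightarrow> nat \<Rightarrow> 'a set \<Rightarrow> ('a \<times> real) set" where
  "dual_gorenstein L r P = {y \<in> dual_cone L P. y \<bullet> (gorenstein_point L r P, real r) = 1}"

definition dual_face ::
  "'a::euclidean_space set \<Rightarrow> nat \<Rightarrow> 'a set \<Rightarrow> 'a set \<Rightarrow> ('a \<times> real) set" where
  "dual_face L r P F = {y \<in> dual_gorenstein L r P. \<forall>x\<in>F. y \<bullet> (x, 1) = 0}"

lemma hstar_empty: "hstar L {} = 1"
proof -
  have "ehrhart_series L {} = 1"
    by (auto simp: ehrhart_series_def dilate_def fps_eq_iff)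
  then show ?thesis
    unfolding hstar_def
    by (intro the_equality)
      (simp, metis aff_dim_empty_eq add.left_inverse nat_0 power_0 fps_divide_1
        fps_of_poly_1 fps_of_poly_eq_iff)
qed

lemma codeg_empty: "codeg L {} = 0"
  by (simp add: codeg_def hstar_empty)

end

theory Submission
  imports Defs
begin

text \<open>
  Write \<open>s\<close> and \<open>t\<close> for the codegrees of \<open>F\<close> and \<open>F\<^sup>*\<close>. A half-open triangulation of the cone over a
  lattice polytope \<open>conv V\<close> shows that \<open>h\<^sup>*\<close> counts the lattice points of half-open parallelepipeds
  by height; reflecting a point of maximal height yields a lattice point \<open>\<Sum> c\<^sub>v (v, 1)\<close> with all
  \<open>c\<^sub>v > 0\<close> whose height is the codegree. This gives \<open>X\<close> over \<open>F\<close> at height \<open>s\<close> and \<open>Y\<close> over \<open>F\<^sup>*\<close> at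
  height \<open>t\<close>.

  For a Gorenstein polytope the dual cone is generated by integral facet normals \<open>w\<close> with
  \<open>w \<bullet> (m, r) = 1\<close>, and \<open>F\<^sup>*\<close> is the hull of those that vanish on \<open>F\<close>. Write the height function as
  \<open>(0, 1) = \<Sum> a\<^sub>w w\<close> with \<open>a\<^sub>w \<ge> 0\<close>; then \<open>\<Sum> a\<^sub>w = r\<close>. The normals that do not vanish on \<open>F\<close> have
  \<open>w \<bullet> X \<ge> 1\<close>, so their coefficients sum to at most \<open>s\<close>. For the others, \<open>Y - \<Sum> a\<^sub>w w\<close> is nonnegative on
  \<open>P\<close>: at a vertex either \<open>Y \<ge> 1\<close>, or \<open>Y\<close> and all these \<open>w\<close> vanish. Evaluating at
  \<open>(m, r)\<close> bounds their coefficients by \<open>t\<close>.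
\<close>

subsection \<open>Regular triangulations of a finitely generated cone\<close>

text \<open>Substituting \<open>t ^ f v\<close> with distinct exponents for the weight of
  \<open>v\<close> turns each nonzero linear form into a nonzero polynomial in \<open>t\<close>.
  Finitely many polynomials have finitely many roots, so some positive \<open>t\<close> avoids them
  all.\<close>

lemma generic_positive_weights:
  fixes A :: "('a \<Rightarrow> real) set"
  assumes "finite V" "finite A" "\<And>a. a \<in> A \<Longrightarrow> \<exists>v\<in>V. a v \<noteq> 0"
  obtains g :: "'a \<Rightarrow> real"
  where "\<And>v. 0 < g v" "\<And>a. a \<in> A \<Longrightarrow> (\<Sum>v\<in>V. g v * a v) \<noteq> 0"
proof -
  obtain f :: "'a \<Rightarrow> nat" where f: "inj_on f V"
    using finite_imp_inj_to_nat_seg[OF assms(1)] by auto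
  define q where "q a = (\<Sum>v\<in>V. monom (a v) (f v))" for a :: "'a \<Rightarrow> real"
  have "q a \<noteq> 0" if a: "a \<in> A" for a
  proof -
    obtain v where v: "v \<in> V" "a v \<noteq> 0" using assms(3)[OF a] by auto
    have "coeff (q a) (f v) = (\<Sum>u\<in>V. if u = v then a v else 0)"
      unfolding q_def coeff_sum
      by (intro sum.cong) (use f v in \<open>auto simp: inj_on_def\<close>)
    also have "\<dots> \<noteq> 0" using v assms(1) by simp
    finally show ?thesis by auto
  qed
  then have "finite (\<Union>a\<in>A. {t. poly (q a) t = 0})"
    using assms(2) by (auto intro: poly_roots_finite)
  moreover have "infinite {0::real<..}" by (simp add: infinite_Ioi)
  ultimately have "\<not> {0<..} \<subseteq> (\<Union>a\<in>A. {t. poly (q a) t = 0})"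
    using finite_subset by blast
  then obtain t where t: "t > 0" "\<And>a. a \<in> A \<Longrightarrow> poly (q a) t \<noteq> 0"
    by auto
  have "poly (q a) t = (\<Sum>v\<in>V. t ^ f v * a v)" for a
    by (simp add: q_def poly_sum poly_monom mult.commute)
  with t show ?thesis using that[of "\<lambda>v. t ^ f v"] by simp
qed

lemma sum_representation:
  fixes S :: "'a::euclidean_space set"
  assumes "independent S" "x \<in> span S"
  shows "(\<Sum>u\<in>S. representation S x u *\<^sub>R u) = x"
  using real_vector.sum_representation_eq[of S x S] assms independent_imp_finite by auto

lemma representation_unique:
  fixes S :: "'a::euclidean_space set"
  assumes "independent S" "u \<in> S"
  shows "representation S (\<Sum>u\<in>S. f u *\<^sub>R u) u = f u"
proof -
  have fin: "finite S" using assms independent_imp_finite by auto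
  have "representation S (\<Sum>u\<in>S. f u *\<^sub>R u) = (\<lambda>u. if u \<in> S then f u else 0)"
  proof (rule real_vector.representation_eqI)
    show "(\<Sum>b | (if b \<in> S then f b else 0) \<noteq> 0. (if b \<in> S then f b else 0) *\<^sub>R b)
        = (\<Sum>u\<in>S. f u *\<^sub>R u)"
      using fin by (intro sum.mono_neutral_cong_left) auto
  qed (use assms fin in \<open>auto simp: span_sum span_scale span_base intro: finite_subset split: if_splits\<close>)
  then show ?thesis using assms by simp
qed

text \<open>The candidates for the maximal simplices of a triangulation, each given by its
  generators.\<close>

definition basis_in :: "'a::euclidean_space set \<Rightarrow> 'a set \<Rightarrow> bool" where
  "basis_in V S \<longleftrightarrow> S \<subseteq> V \<and> independent S \<and> span S = span V"

text \<open>Positivity of the \<open>u\<close>-coordinate of \<open>x + \<epsilon> p\<close> for all sufficiently small \<open>\<epsilon> > 0\<close>.\<close>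

definition lex_pos :: "'a::euclidean_space \<Rightarrow> 'a set \<Rightarrow> 'a \<Rightarrow> 'a \<Rightarrow> bool" where
  "lex_pos p S x u \<longleftrightarrow> 0 < representation S x u \<or>
     (representation S x u = 0 \<and> 0 < representation S p u)"

text \<open>
  The simplices of the regular triangulation with heights \<open>\<omega>\<close>: the linear function that agrees with
  \<open>\<omega>\<close> on \<open>S\<close> lies strictly below \<open>\<omega>\<close> on the other generators.
\<close>

definition regular_basis :: "('a::euclidean_space \<Rightarrow> real) \<Rightarrow> 'a set \<Rightarrow> 'a set \<Rightarrow> bool" where
  "regular_basis \<omega> V S \<longleftrightarrow> basis_in V S \<and>
     (\<forall>v\<in>V - S. (\<Sum>u\<in>S. representation S v u * \<omega> u) < \<omega> v)"

lemma representation_linear_comb: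
  fixes S :: "'a::euclidean_space set"
  assumes "independent S" "\<And>v. v \<in> V \<Longrightarrow> v \<in> span S"
  shows "representation S (\<Sum>v\<in>V. c v *\<^sub>R v) u = (\<Sum>v\<in>V. c v * representation S v u)"
  using assms
  by (simp add: real_vector.representation_sum real_vector.representation_scale span_scale)

text \<open>The linear function that agrees with \<omega> on \<open>S\<close> is at most \<omega> on
  all of \<open>V\<close>, and strictly smaller off \<open>S\<close>. Weighting this by the
  coefficients \<open>c\<close> shows that the expansion over \<open>S\<close> is the cheapest one;
  this is weak linear programming duality with \<open>S\<close> as dual certificate.\<close>

lemma regular_basis_cost_le:
  assumes "regular_basis \<omega> V S" "T \<subseteq> V" "finite T"
    and y: "y = (\<Sum>t\<in>T. c t *\<^sub>R t)" and c: "\<And>t. t \<in> T \<Longrightarrow> 0 < c t"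
  shows "(\<Sum>u\<in>S. representation S y u * \<omega> u) \<le> (\<Sum>t\<in>T. c t * \<omega> t)"
    and "\<not> T \<subseteq> S \<Longrightarrow> (\<Sum>u\<in>S. representation S y u * \<omega> u) < (\<Sum>t\<in>T. c t * \<omega> t)"
proof -
  have S: "S \<subseteq> V" "independent S" "span S = span V"
    using assms(1) by (auto simp: regular_basis_def basis_in_def)
  define \<phi> where "\<phi> t = (\<Sum>u\<in>S. representation S t u * \<omega> u)" for t
  have "(\<Sum>u\<in>S. representation S y u * \<omega> u) = (\<Sum>u\<in>S. \<Sum>t\<in>T. c t * representation S t u * \<omega> u)"
    unfolding y using S assms(2)
    by (subst representation_linear_comb) (auto simp: span_base subsetD sum_distrib_right)
  also have "\<dots> = (\<Sum>t\<in>T. c t * \<phi> t)"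
    by (subst sum.swap) (simp add: \<phi>_def sum_distrib_left mult.assoc)
  finally have eq: "(\<Sum>u\<in>S. representation S y u * \<omega> u) = (\<Sum>t\<in>T. c t * \<phi> t)" .
  have in_S: "\<phi> t = \<omega> t" if "t \<in> S" for t
  proof -
    have "\<phi> t = (\<Sum>u\<in>S. if u = t then \<omega> t else 0)"
      unfolding \<phi>_def by (intro sum.cong) (use S that in \<open>auto simp: real_vector.representation_basis\<close>)
    then show ?thesis using that S by (simp add: independent_imp_finite)
  qed
  have notin: "\<phi> t < \<omega> t" if "t \<in> T" "t \<notin> S" for t
    using assms(1,2) that by (auto simp: regular_basis_def \<phi>_def)
  have le: "c t * \<phi> t \<le> c t * \<omega> t" if "t \<in> T" for t
    using in_S notin c[OF that] that by (cases "t \<in> S") (auto intro!: mult_left_mono simp: less_imp_le)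
  show "(\<Sum>u\<in>S. representation S y u * \<omega> u) \<le> (\<Sum>t\<in>T. c t * \<omega> t)"
    unfolding eq by (intro sum_mono le)
  show "(\<Sum>u\<in>S. representation S y u * \<omega> u) < (\<Sum>t\<in>T. c t * \<omega> t)" if "\<not> T \<subseteq> S"
    unfolding eq using that notin c le
    by (intro sum_strict_mono_ex1 \<open>finite T\<close>) (auto intro!: bexI)
qed

text \<open>The coordinate is affine in \<open>e\<close> with nonzero slope, so for small positive
  \<open>e\<close> its sign is that of the constant term or, if this vanishes, that of the
  slope.\<close>

lemma lex_pos_eventually:
  fixes S :: "'a::euclidean_space set"
  assumes "independent S" "x \<in> span S" "p \<in> span S"
    and "representation S p u \<noteq> 0"
  shows "\<forall>\<^sub>F e in at_right 0. representation S (x + e *\<^sub>R p) u \<noteq> 0 \<and>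
           (0 < representation S (x + e *\<^sub>R p) u \<longleftrightarrow> lex_pos p S x u)"
proof -
  let ?a = "representation S x u" and ?b = "representation S p u"
  have eq: "representation S (x + e *\<^sub>R p) u = ?a + e * ?b" for e
    using assms by (simp add: real_vector.representation_add real_vector.representation_scale span_scale)
  have lim: "((\<lambda>e. ?a + e * ?b) \<longlongrightarrow> ?a) (at_right 0)"
    by (auto intro!: tendsto_eq_intros)
  consider "?a > 0" | "?a < 0" | "?a = 0" by linarith
  then show ?thesis
  proof cases
    case 1
    then have "\<forall>\<^sub>F e in at_right 0. ?a + e * ?b > 0" using lim by (rule order_tendstoD(1)[rotated])
    then show ?thesis by eventually_elim (use 1 in \<open>auto simp: eq lex_pos_def\<close>)
  next
    case 2
    then have "\<forall>\<^sub>F e in at_right 0. ?a + e * ?b < 0" using lim by (rule order_tendstoD(2)[rotated])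
    then show ?thesis by eventually_elim (use 2 in \<open>auto simp: eq lex_pos_def\<close>)
  next
    case 3
    have "\<forall>\<^sub>F e in at_right (0::real). e > 0" by (rule eventually_at_right_less)
    then show ?thesis
      by eventually_elim (use 3 assms(4) in \<open>auto simp: eq lex_pos_def zero_less_mult_iff\<close>)
  qed
qed

text \<open>A small perturbation of \<open>x\<close> towards \<open>p\<close> lies in the interior
  of both simplicial cones. Each expansion is then at most as expensive as the other, and strictly
  cheaper if the other uses a foreign generator; hence \<open>S\<close> and \<open>T\<close> contain
  each other.\<close>

lemma regular_basis_lex_unique:
  assumes S: "regular_basis \<omega> V S" and T: "regular_basis \<omega> V T"
    and x: "x \<in> span V" "p \<in> span V"
    and gen: "\<And>B u. basis_in V B \<Longrightarrow> u \<in> B \<Longrightarrow> representation B p u \<noteq> 0"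
    and "\<forall>u\<in>S. lex_pos p S x u" "\<forall>u\<in>T. lex_pos p T x u"
  shows "S = T"
proof -
  have bS: "basis_in V S" "S \<subseteq> V" "independent S" "span S = span V" "finite S"
    and bT: "basis_in V T" "T \<subseteq> V" "independent T" "span T = span V" "finite T"
    using S T by (auto simp: regular_basis_def basis_in_def independent_imp_finite)
  have "\<forall>\<^sub>F e in at_right 0. \<forall>u\<in>S. 0 < representation S (x + e *\<^sub>R p) u"
    using assms(6) bS x
    by (auto intro!: eventually_ball_finite eventually_mono[OF lex_pos_eventually[of S x p]] dest: gen[OF bS(1)])
  moreover have "\<forall>\<^sub>F e in at_right 0. \<forall>u\<in>T. 0 < representation T (x + e *\<^sub>R p) u"
    using assms(7) bT x
    by (auto intro!: eventually_ball_finite eventually_mono[OF lex_pos_eventually[of T x p]] dest: gen[OF bT(1)])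
  ultimately have "\<forall>\<^sub>F e in at_right 0. (\<forall>u\<in>S. 0 < representation S (x + e *\<^sub>R p) u) \<and>
      (\<forall>u\<in>T. 0 < representation T (x + e *\<^sub>R p) u)" by eventually_elim auto
  then obtain e where e: "\<forall>u\<in>S. 0 < representation S (x + e *\<^sub>R p) u"
     "\<forall>u\<in>T. 0 < representation T (x + e *\<^sub>R p) u"
    using eventually_happens'[OF trivial_limit_at_right_real] by blast
  define y where "y = x + e *\<^sub>R p"
  have y: "y \<in> span V" using x by (simp add: y_def span_add span_scale)
  have yS: "y = (\<Sum>u\<in>S. representation S y u *\<^sub>R u)" and yT: "y = (\<Sum>u\<in>T. representation T y u *\<^sub>R u)"
    using y bS bT by (simp_all add: sum_representation)
  have S1: "\<And>u. u \<in> S \<Longrightarrow> 0 < representation S y u" and T1: "\<And>u. u \<in> T \<Longrightarrow> 0 < representation T y u"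
    using e by (auto simp: y_def)
  note 1 = regular_basis_cost_le[OF S bT(2,5) yT T1]
  note 2 = regular_basis_cost_le[OF T bS(2,5) yS S1]
  show ?thesis using 1 2 by fastforce
qed

section \<open>Caratheodory reduction, simplex pivots and existence of a regular basis\<close>

text \<open>Subtracting a multiple of a linear relation until the first coefficient vanishes keeps
  the others nonnegative and removes one generator.\<close>

lemma conic_caratheodory:
  fixes V :: "'a::euclidean_space set"
  assumes "finite V" "\<And>v. v \<in> V \<Longrightarrow> 0 \<le> c v"
  shows "\<exists>S c'. S \<subseteq> V \<and> independent S \<and> (\<forall>u\<in>S. 0 \<le> c' u) \<and>
           (\<Sum>v\<in>V. c v *\<^sub>R v) = (\<Sum>u\<in>S. c' u *\<^sub>R u)"
  using assms
proof (induction V arbitrary: c rule: finite_psubset_induct)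
  case (psubset V)
  show ?case
  proof (cases "independent V")
    case True
    then show ?thesis using psubset.prems by blast
  next
    case False
    then obtain d0 v0 where d0: "v0 \<in> V" "d0 v0 \<noteq> 0" "(\<Sum>v\<in>V. d0 v *\<^sub>R v) = 0"
      using dependent_finite[OF psubset.hyps(1)] by auto
    \<comment> \<open>The sign is normalised so that the relation has a positive coefficient, which
      the ratio test below requires.\<close>
    define d where "d v = (if d0 v0 > 0 then d0 v else - d0 v)" for v
    have d: "d v0 > 0" "(\<Sum>v\<in>V. d v *\<^sub>R v) = 0"
      using d0 by (cases "d0 v0 > 0"; simp add: d_def sum_negf)+
    define D where "D = {v\<in>V. d v > 0}"
    have D: "finite D" "D \<noteq> {}" using d d0 psubset.hyps by (auto simp: D_def)
    \<comment> \<open>The minimal ratio is the largest multiple of the relation that can be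
      subtracted without making a coefficient negative; it is attained at \<open>w\<close>, which
      drops out.\<close>
    define w where "w = arg_min_on (\<lambda>v. c v / d v) D"
    have w: "w \<in> D" "\<And>v. v \<in> D \<Longrightarrow> c w / d w \<le> c v / d v"
      unfolding w_def using D by (auto intro: arg_min_if_finite(1) arg_min_least)
    define \<theta> where "\<theta> = c w / d w"
    have \<theta>: "\<theta> \<ge> 0" using w(1) psubset.prems by (auto simp: \<theta>_def D_def)
    define c' where "c' v = c v - \<theta> * d v" for v
    have c'0: "0 \<le> c' v" if "v \<in> V" for v
    proof (cases "d v > 0")
      case True
      then have "\<theta> \<le> c v / d v" using w(2) that by (auto simp: \<theta>_def D_def)
      then show ?thesis using True by (simp add: c'_def field_simps)
    next
      case False
      then show ?thesis using psubset.prems[OF that] \<theta>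
        by (simp add: c'_def mult_nonneg_nonpos add_increasing2 order_trans[of _ 0])
    qed
    have "c' w = 0" using w(1) by (simp add: c'_def \<theta>_def D_def)
    have wV: "w \<in> V" using w by (simp add: D_def)
    have "(\<Sum>v\<in>V. c v *\<^sub>R v) = (\<Sum>v\<in>V. c' v *\<^sub>R v) + \<theta> *\<^sub>R (\<Sum>v\<in>V. d v *\<^sub>R v)"
      by (simp add: c'_def scaleR_left_diff_distrib sum_subtractf scaleR_sum_right)
    also have "\<dots> = (\<Sum>v\<in>V - {w}. c' v *\<^sub>R v)"
      using d \<open>c' w = 0\<close> psubset.hyps wV by (simp add: sum.remove)
    finally have eq: "(\<Sum>v\<in>V. c v *\<^sub>R v) = (\<Sum>v\<in>V - {w}. c' v *\<^sub>R v)" .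
    have "V - {w} \<subset> V" using wV by auto
    from psubset.IH[OF this, of c'] c'0 show ?thesis unfolding eq by blast
  qed
qed

text \<open>The value at \<open>y\<close> of the linear function that interpolates \<omega> on
  \<open>S\<close>; for a basis it is also the objective function of the linear program that expands
  \<open>y\<close> over \<open>V\<close>.\<close>

definition basis_cost :: "('a::euclidean_space \<Rightarrow> real) \<Rightarrow> 'a set \<Rightarrow> 'a \<Rightarrow> real" where
  "basis_cost \<omega> S y = (\<Sum>u\<in>S. representation S y u * \<omega> u)"

text \<open>One step of the simplex method: \<open>v\<close> enters the basis with amount \<theta>
  and \<open>w\<close> leaves it. The cost changes by \<theta> times the reduced cost
  \<open>\<omega> v - basis_cost \<omega> S v\<close>, which is negative, and \<theta> is positive
  because all coordinates of \<open>y\<close> are.\<close>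

lemma basis_pivot:
  assumes S: "basis_in V S" and y: "y \<in> span V" and v: "v \<in> V - S"
    and pos: "\<And>u. u \<in> S \<Longrightarrow> 0 < representation S y u"
    and "\<exists>u\<in>S. 0 < representation S v u"
    and less: "\<omega> v < basis_cost \<omega> S v"
  shows "\<exists>T. basis_in V T \<and> (\<forall>u\<in>T. 0 \<le> representation T y u) \<and>
           basis_cost \<omega> T y < basis_cost \<omega> S y"
proof -
  have bS: "S \<subseteq> V" "independent S" "span S = span V" "finite S"
    using S by (auto simp: basis_in_def independent_imp_finite)
  define a where "a = representation S v"
  define l where "l = representation S y"
  define D where "D = {u\<in>S. a u > 0}"
  have D: "finite D" "D \<noteq> {}" using assms(5) bS by (auto simp: D_def a_def)
  \<comment> \<open>Ratio test: as the amount of \<open>v\<close> grows, the coordinate at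
    \<open>w\<close> is the first to reach zero.\<close>
  define w where "w = arg_min_on (\<lambda>u. l u / a u) D"
  have w: "w \<in> D" "\<And>u. u \<in> D \<Longrightarrow> l w / a w \<le> l u / a u"
    unfolding w_def using D by (auto intro: arg_min_if_finite(1) arg_min_least)
  have wS: "w \<in> S" "a w > 0" using w by (auto simp: D_def)
  define \<theta> where "\<theta> = l w / a w"
  have \<theta>: "\<theta> > 0" using pos wS by (simp add: \<theta>_def l_def)
  define T where "T = insert v (S - {w})"
  have vspan: "v \<in> span S" using v bS span_base by auto
  \<comment> \<open>The coordinate of \<open>v\<close> at \<open>w\<close> is nonzero, so exchanging
    \<open>w\<close> for \<open>v\<close> preserves independence and the span.\<close>
  have vn: "v \<notin> span (S - {w})"
  proof
    assume "v \<in> span (S - {w})"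
    then have "representation S v = representation (S - {w}) v"
      using bS by (intro real_vector.representation_extend) auto
    then have "representation (S - {w}) v w \<noteq> 0" using wS by (simp add: a_def)
    then show False using real_vector.representation_ne_zero by blast
  qed
  have "independent T" unfolding T_def
    using vn independent_mono[OF bS(2), of "S - {w}"] by (intro independent_insertI) auto
  have ins: "insert w (S - {w}) = S" using wS by auto
  have "w \<in> span T" unfolding T_def
    using in_span_insert[of v w "S - {w}", unfolded ins] vn vspan by blast
  then have "S \<subseteq> span T" unfolding T_def by (auto intro: span_base)
  then have "span V \<subseteq> span T" using bS(3) span_minimal[OF _ subspace_span] by blast
  moreover have "T \<subseteq> V" using v bS by (auto simp: T_def)
  ultimately have T: "basis_in V T"
    using \<open>independent T\<close> span_mono[of T V] by (auto simp: basis_in_def)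
  have finT: "finite T" using bS by (simp add: T_def)
  define c where "c u = (if u = v then \<theta> else l u - \<theta> * a u)" for u
  \<comment> \<open>The coefficient at \<open>w\<close> vanishes by the choice of \<theta>, so the
    sum may run over all of \<open>S\<close>. The summand \<open>g\<close> is left general to serve
    both the vector \<open>y\<close> and its cost.\<close>
  have split: "(\<Sum>u\<in>T. g (c u) u) = g \<theta> v + (\<Sum>u\<in>S. g (l u - \<theta> * a u) u)"
    if "\<And>u. g 0 u = (0::'c::comm_monoid_add)" for g
  proof -
    have "(\<Sum>u\<in>T. g (c u) u) = g \<theta> v + (\<Sum>u\<in>S - {w}. g (c u) u)"
      using v bS by (simp add: T_def c_def)
    also have "(\<Sum>u\<in>S - {w}. g (c u) u) = (\<Sum>u\<in>S - {w}. g (l u - \<theta> * a u) u)"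
      using v by (intro sum.cong) (auto simp: c_def)
    also have "\<dots> = (\<Sum>u\<in>S. g (l u - \<theta> * a u) u)"
      using wS that bS by (simp add: sum.remove \<theta>_def)
    finally show ?thesis .
  qed
  have "(\<Sum>u\<in>T. c u *\<^sub>R u) = \<theta> *\<^sub>R v + (\<Sum>u\<in>S. (l u - \<theta> * a u) *\<^sub>R u)"
    by (rule split) simp
  also have "(\<Sum>u\<in>S. (l u - \<theta> * a u) *\<^sub>R u) = (\<Sum>u\<in>S. l u *\<^sub>R u) - \<theta> *\<^sub>R (\<Sum>u\<in>S. a u *\<^sub>R u)"
    by (simp add: scaleR_left_diff_distrib sum_subtractf scaleR_sum_right)
  also have "\<dots> = y - \<theta> *\<^sub>R v"
    using bS y vspan by (simp add: l_def a_def sum_representation)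
  finally have yT: "(\<Sum>u\<in>T. c u *\<^sub>R u) = y" by simp
  have rep: "representation T y u = c u" if "u \<in> T" for u
    using representation_unique[OF \<open>independent T\<close> that, of c] by (simp add: yT)
  have "0 \<le> c u" if "u \<in> T" for u
  proof (cases "u = v")
    case False
    then have u: "u \<in> S" using that by (auto simp: T_def)
    show ?thesis
    proof (cases "a u > 0")
      case True
      then have "\<theta> \<le> l u / a u" using w(2) u by (auto simp: \<theta>_def D_def)
      then show ?thesis using True False by (simp add: c_def field_simps)
    next
      case 2: False
      then have "\<theta> * a u \<le> 0" using \<theta> by (simp add: mult_nonneg_nonpos)
      moreover have "0 < l u" using pos[OF u] by (simp add: l_def)
      ultimately show ?thesis using False by (simp add: c_def)
    qed
  qed (use \<theta> in \<open>simp add: c_def\<close>)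
  moreover have "basis_cost \<omega> T y < basis_cost \<omega> S y"
  proof -
    have "basis_cost \<omega> T y = (\<Sum>u\<in>T. c u * \<omega> u)"
      unfolding basis_cost_def by (simp add: rep)
    also have "\<dots> = \<theta> * \<omega> v + (\<Sum>u\<in>S. (l u - \<theta> * a u) * \<omega> u)"
      by (rule split) simp
    also have "\<dots> = \<theta> * \<omega> v + (basis_cost \<omega> S y - \<theta> * basis_cost \<omega> S v)"
      by (simp add: basis_cost_def l_def a_def left_diff_distrib sum_subtractf sum_distrib_left mult.assoc)
    also have "\<dots> < basis_cost \<omega> S y" using less \<theta> by simp
    finally show ?thesis .
  qed
  ultimately show ?thesis using T rep by auto
qed

lemma linear_lincomb:
  fixes h :: "'a::real_vector \<Rightarrow> real"
  assumes "linear h"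
  shows "h (\<Sum>u\<in>S. c u *\<^sub>R u) = (\<Sum>u\<in>S. c u * h u)"
  using assms by (simp add: linear_sum linear_scale)

text \<open>Perturbing \<open>x\<close> towards \<open>p\<close> gives a point with a feasible basis
  by Caratheodory. A feasible basis of least cost is regular, since a violated inequality would
  allow a pivot that lowers the cost.\<close>

lemma regular_basis_lex_exists:
  fixes V :: "'a::euclidean_space set"
  assumes fin: "finite V" and h: "linear h" "\<And>v. v \<in> V \<Longrightarrow> h v = (1::real)"
    and g: "\<And>v. v \<in> V \<Longrightarrow> 0 < g v" and p: "p = (\<Sum>v\<in>V. g v *\<^sub>R v)"
    and c: "\<And>v. v \<in> V \<Longrightarrow> 0 \<le> c v" and x: "x = (\<Sum>v\<in>V. c v *\<^sub>R v)"
    and genp: "\<And>B u. basis_in V B \<Longrightarrow> u \<in> B \<Longrightarrow> representation B p u \<noteq> 0"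
    and gen\<omega>: "\<And>B v. basis_in V B \<Longrightarrow> v \<in> V - B \<Longrightarrow> basis_cost \<omega> B v \<noteq> \<omega> v"
  shows "\<exists>S. regular_basis \<omega> V S \<and> (\<forall>u\<in>S. lex_pos p S x u)"
proof -
  have spn: "x \<in> span V" "p \<in> span V" unfolding x p by (intro span_sum span_scale span_base; assumption)+
  have finB: "finite {B. basis_in V B}"
    by (rule finite_subset[of _ "Pow V"]) (auto simp: basis_in_def fin)
  have bas: "B \<subseteq> V" "independent B" "span B = span V" "finite B" if "basis_in V B" for B
    using that by (auto simp: basis_in_def independent_imp_finite)
  \<comment> \<open>There are finitely many bases, so a single \<open>e\<close> turns lexicographic
    positivity into strict positivity for all of them at once and excludes zero coordinates, which
    makes every feasible basis nondegenerate.\<close>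
  have "\<forall>\<^sub>F e in at_right 0. \<forall>B\<in>{B. basis_in V B}. \<forall>u\<in>B. representation B (x + e *\<^sub>R p) u \<noteq> 0 \<and>
           (0 < representation B (x + e *\<^sub>R p) u \<longleftrightarrow> lex_pos p B x u)"
  proof (intro eventually_ball_finite ballI finB)
    fix B u assume "B \<in> {B. basis_in V B}" "u \<in> B"
    then show "\<forall>\<^sub>F e in at_right 0. representation B (x + e *\<^sub>R p) u \<noteq> 0 \<and>
           (0 < representation B (x + e *\<^sub>R p) u \<longleftrightarrow> lex_pos p B x u)"
      using bas[of B] spn by (intro lex_pos_eventually genp) auto
  qed (use bas in auto)
  moreover have "\<forall>\<^sub>F e in at_right (0::real). e > 0" by (rule eventually_at_right_less)
  ultimately have "\<forall>\<^sub>F e in at_right 0. e > 0 \<and> (\<forall>B. basis_in V B \<longrightarrow> (\<forall>u\<in>B. representation B (x + e *\<^sub>R p) u \<noteq> 0 \<and>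
           (0 < representation B (x + e *\<^sub>R p) u \<longleftrightarrow> lex_pos p B x u)))"
    by eventually_elim auto
  then obtain e where e: "e > 0" "\<And>B u. basis_in V B \<Longrightarrow> u \<in> B \<Longrightarrow> representation B (x + e *\<^sub>R p) u \<noteq> 0"
     "\<And>B u. basis_in V B \<Longrightarrow> u \<in> B \<Longrightarrow> (0 < representation B (x + e *\<^sub>R p) u \<longleftrightarrow> lex_pos p B x u)"
    using eventually_happens'[OF trivial_limit_at_right_real] by blast
  define y where "y = x + e *\<^sub>R p"
  have y: "y \<in> span V" using spn by (simp add: y_def span_add span_scale)
  have "y = (\<Sum>v\<in>V. (c v + e * g v) *\<^sub>R v)"
    by (simp add: y_def x p scaleR_left_distrib sum.distrib scaleR_sum_right)
  moreover have "0 \<le> c v + e * g v" if "v \<in> V" for v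
    using c[OF that] g[OF that] e(1) by simp
  ultimately obtain S0 c0 where S0: "S0 \<subseteq> V" "independent S0" "\<forall>u\<in>S0. 0 \<le> c0 u"
      "y = (\<Sum>u\<in>S0. c0 u *\<^sub>R u)"
    using conic_caratheodory[OF fin, of "\<lambda>v. c v + e * g v"] by auto
  \<comment> \<open>The independent set from Caratheodory may be too small; it is completed inside
    \<open>V\<close>, with zero coefficients on the new elements.\<close>
  obtain B0 where B0: "S0 \<subseteq> B0" "B0 \<subseteq> V" "independent B0" "V \<subseteq> span B0"
    using maximal_independent_subset_extend[OF S0(1,2)] by metis
  have bB0: "basis_in V B0" using B0 span_mono[of B0 V] span_minimal[OF B0(4) subspace_span]
    by (auto simp: basis_in_def)
  have "y = (\<Sum>u\<in>B0. (if u \<in> S0 then c0 u else 0) *\<^sub>R u)"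
    unfolding S0(4) using B0 bas[OF bB0] by (intro sum.mono_neutral_cong_left) auto
  then have "representation B0 y u = (if u \<in> S0 then c0 u else 0)" if "u \<in> B0" for u
    using representation_unique[OF B0(3) that, of "\<lambda>u. if u \<in> S0 then c0 u else 0"] by simp
  then have nn0: "\<forall>u\<in>B0. 0 \<le> representation B0 y u" using S0 by auto
  define Bs where "Bs = {B. basis_in V B \<and> (\<forall>u\<in>B. 0 \<le> representation B y u)}"
  have Bs: "finite Bs" "Bs \<noteq> {}" using finB nn0 bB0 by (auto simp: Bs_def)
  define S where "S = arg_min_on (\<lambda>B. basis_cost \<omega> B y) Bs"
  have S: "S \<in> Bs" "\<And>B. B \<in> Bs \<Longrightarrow> basis_cost \<omega> S y \<le> basis_cost \<omega> B y"
    unfolding S_def using Bs by (auto intro: arg_min_if_finite(1) arg_min_least)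
  have bS: "basis_in V S" using S by (simp add: Bs_def)
  have pos: "0 < representation S y u" if "u \<in> S" for u
    using S(1) e(2)[OF bS that] that by (auto simp: Bs_def y_def order_less_le)
  have "basis_cost \<omega> S v < \<omega> v" if v: "v \<in> V - S" for v
  proof (rule ccontr)
    assume "\<not> basis_cost \<omega> S v < \<omega> v"
    then have less: "\<omega> v < basis_cost \<omega> S v" using gen\<omega>[OF bS v] by auto
    \<comment> \<open>All generators have height one, so the coordinates of \<open>v\<close> sum to
      one and some coordinate is positive: the pivot has a leaving generator.\<close>
    have "v = (\<Sum>u\<in>S. representation S v u *\<^sub>R u)"
      using bas[OF bS] v by (simp add: sum_representation span_base)
    then have "h v = (\<Sum>u\<in>S. representation S v u * h u)"
      by (metis linear_lincomb[OF h(1)])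
    then have "(\<Sum>u\<in>S. representation S v u) = 1"
      using h(2) v bas[OF bS] by (simp add: subset_iff)
    then have "\<exists>u\<in>S. 0 < representation S v u"
      by (metis not_less sum_nonpos zero_less_one)
    from basis_pivot[OF bS y v pos this less] S(2) show False
      by (auto simp: Bs_def not_less[symmetric])
  qed
  then have "regular_basis \<omega> V S" using bS by (auto simp: regular_basis_def basis_cost_def)
  moreover have "\<forall>u\<in>S. lex_pos p S x u" using pos e(3)[OF bS] by (auto simp: y_def)
  ultimately show ?thesis by blast
qed

subsection \<open>Counting lattice points in half-open cones\<close>

definition nonneg_combs :: "'a::euclidean_space set \<Rightarrow> 'a set" where
  "nonneg_combs V = {\<Sum>v\<in>V. c v *\<^sub>R v |c. \<forall>v\<in>V. 0 \<le> c v}"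

text \<open>\<open>L\<close> is only asked to be an additive subgroup with finite levels in the
  cone, so the count applies to the original lattice and to the extended dual lattice, each with a
  height coordinate adjoined.\<close>

locale lattice_cone =
  fixes V L :: "'a::euclidean_space set" and h :: "'a \<Rightarrow> real"
  assumes finite_V: "finite V" and V_subset: "V \<subseteq> L"
    and linear_h: "linear h" and h_V: "\<And>v. v \<in> V \<Longrightarrow> h v = 1"
    and zero_L: "0 \<in> L" and diff_L: "\<And>x y. x \<in> L \<Longrightarrow> y \<in> L \<Longrightarrow> x - y \<in> L"
    and finite_level: "\<And>k::nat. finite {x \<in> L. h x = real k \<and> x \<in> nonneg_combs V}"
begin

text \<open>
  Lattice points of the half-open cone over \<open>S\<close> whose coordinates along \<open>T\<close> lie in the half-open unit
  interval; \<open>T = {}\<close> gives the whole cone and \<open>T = S\<close> the half-open fundamental parallelepiped.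
\<close>

definition cell :: "'a \<Rightarrow> 'a set \<Rightarrow> 'a set \<Rightarrow> nat \<Rightarrow> 'a set" where
  "cell p S T k = {x \<in> L. x \<in> span V \<and> h x = real k \<and> (\<forall>u\<in>S. lex_pos p S x u) \<and>
     (\<forall>u\<in>T. \<not> lex_pos p S (x - u) u)}"

lemma uminus_L: "x \<in> L \<Longrightarrow> - x \<in> L"
  using diff_L[OF zero_L] by simp

lemma add_L: "x \<in> L \<Longrightarrow> y \<in> L \<Longrightarrow> x + y \<in> L"
  using diff_L[of x "- y"] uminus_L by simp

lemma sum_L: "(\<And>i. i \<in> I \<Longrightarrow> f i \<in> L) \<Longrightarrow> sum f I \<in> L"
  by (induction I rule: infinite_finite_induct) (auto simp: zero_L add_L)

lemma lex_pos_ge_0: "lex_pos p S x u \<Longrightarrow> 0 \<le> representation S x u"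
  by (auto simp: lex_pos_def)

lemma basis_inD:
  assumes "basis_in V S"
  shows "S \<subseteq> V" "independent S" "span S = span V" "finite S"
  using assms by (auto simp: basis_in_def independent_imp_finite)

lemma representation_shift:
  assumes "basis_in V S" "x \<in> span V" "u \<in> S" "w \<in> S"
  shows "representation S (x - u) w = representation S x w - (if w = u then 1 else 0)"
proof -
  note b = basis_inD[OF assms(1)]
  have "representation S (x - u) = (\<lambda>w. representation S x w - representation S u w)"
    using b assms by (intro real_vector.representation_diff) (auto intro: span_base)
  then show ?thesis using b assms(3) by (simp add: real_vector.representation_basis)
qed

lemma height_eq_sum:
  assumes "basis_in V S" "x \<in> span V"
  shows "h x = (\<Sum>u\<in>S. representation S x u)"
proof -
  note b = basis_inD[OF assms(1)]
  have "h x = h (\<Sum>u\<in>S. representation S x u *\<^sub>R u)"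
    using b assms by (simp add: sum_representation)
  also have "\<dots> = (\<Sum>u\<in>S. representation S x u)"
    unfolding linear_lincomb[OF linear_h] using b h_V by (intro sum.cong) auto
  finally show ?thesis .
qed

lemma cell_subset:
  assumes S: "basis_in V S"
  shows "cell p S T k \<subseteq> {x \<in> L. h x = real k \<and> x \<in> nonneg_combs V}"
proof
  fix x assume x: "x \<in> cell p S T k"
  note b = basis_inD[OF S]
  have "x = (\<Sum>u\<in>S. representation S x u *\<^sub>R u)"
    using b x by (simp add: sum_representation cell_def)
  also have "\<dots> = (\<Sum>u\<in>V. (if u \<in> S then representation S x u else 0) *\<^sub>R u)"
    using b finite_V by (intro sum.mono_neutral_cong_left) auto
  finally have "x \<in> nonneg_combs V"
    unfolding nonneg_combs_def using x lex_pos_ge_0[of p S x]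
    by (auto simp: cell_def intro!: exI)
  then show "x \<in> {x \<in> L. h x = real k \<and> x \<in> nonneg_combs V}"
    using x by (auto simp: cell_def)
qed

lemma finite_cell: "basis_in V S \<Longrightarrow> finite (cell p S T k)"
  by (rule finite_subset[OF cell_subset finite_level])

text \<open>A point whose \<open>u\<close>-coordinate stays positive after subtracting
  \<open>u\<close> is the translate by \<open>u\<close> of a point one level lower; the remaining
  points have this coordinate in the half-open unit interval.\<close>

lemma cell_split:
  assumes S: "basis_in V S" and T: "T \<subseteq> S" and u: "u \<in> S - T"
  shows "cell p S T k = cell p S (insert u T) k \<union>
     (if k = 0 then {} else (\<lambda>y. y + u) ` cell p S T (k - 1))" (is "_ = _ \<union> ?R")
    and "cell p S (insert u T) k \<inter>
     (if k = 0 then {} else (\<lambda>y. y + u) ` cell p S T (k - 1)) = {}"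
proof -
  note b = basis_inD[OF S]
  have uL: "u \<in> L" "u \<in> span V" "h u = 1" using u b V_subset h_V by (auto intro: span_base)
  have up: "y + u \<in> cell p S T k \<and> lex_pos p S (y + u - u) u"
    if k: "k \<noteq> 0" and y: "y \<in> cell p S T (k - 1)" for y
  proof -
    have ys: "y \<in> span V" and lp: "\<And>w. w \<in> S \<Longrightarrow> lex_pos p S y w" using y by (auto simp: cell_def)
    have yus: "y + u \<in> span V" using ys uL by (simp add: span_add)
    have rep: "representation S (y + u) w = representation S y w + (if w = u then 1 else 0)"
      if "w \<in> S" for w
      using representation_shift[OF S yus _ that, of u] u by simp
    have "lex_pos p S (y + u) w" if "w \<in> S" for w
      using lp[OF that] rep[OF that] by (auto simp: lex_pos_def)
    moreover have "\<not> lex_pos p S (y + u - w) w" if w: "w \<in> T" for w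
    proof -
      have wS: "w \<in> S" "w \<noteq> u" using w T u by auto
      have "representation S (y + u - w) w = representation S (y - w) w"
        using representation_shift[OF S yus wS(1) wS(1)] representation_shift[OF S ys wS(1) wS(1)] rep[OF wS(1)] wS
        by simp
      then show ?thesis using y w by (auto simp: cell_def lex_pos_def)
    qed
    moreover have "h (y + u) = real k"
      using linear_h y uL k by (simp add: linear_add cell_def of_nat_diff)
    ultimately show ?thesis using y lp u yus uL by (auto simp: cell_def add_L)
  qed
  have down: "k \<noteq> 0 \<and> x - u \<in> cell p S T (k - 1)"
    if x: "x \<in> cell p S T k" and l: "lex_pos p S (x - u) u" for x
  proof -
    have xs: "x \<in> span V" and lp: "\<And>w. w \<in> S \<Longrightarrow> lex_pos p S x w" using x by (auto simp: cell_def)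
    have xus: "x - u \<in> span V" using xs uL by (simp add: span_diff)
    have lp': "lex_pos p S (x - u) w" if "w \<in> S" for w
      using lp[OF that] l representation_shift[OF S xs _ that, of u] u
      by (cases "w = u") (auto simp: lex_pos_def)
    have hx: "h (x - u) = real k - 1" using linear_h x uL by (simp add: linear_diff cell_def)
    \<comment> \<open>The height is the sum of the coordinates, hence nonnegative at
      \<open>x - u\<close>; this excludes \<open>k = 0\<close>, so that \<open>k - 1\<close> is a
      genuine predecessor.\<close>
    have "0 \<le> h (x - u)"
      unfolding height_eq_sum[OF S xus] using lp' by (intro sum_nonneg lex_pos_ge_0)
    then have k: "k \<noteq> 0" using hx by (cases k) auto
    have "\<not> lex_pos p S (x - u - w) w" if w: "w \<in> T" for w
    proof -
      have wS: "w \<in> S" "w \<noteq> u" using w T u by auto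
      have "representation S (x - u - w) w = representation S (x - w) w"
        using representation_shift[OF S xus wS(1) wS(1)] representation_shift[OF S xs wS(1) wS(1)]
          representation_shift[OF S xs _ wS(1), of u] wS u
        by simp
      then show ?thesis using x w by (auto simp: cell_def lex_pos_def)
    qed
    then show ?thesis using x lp' xus hx k uL diff_L by (auto simp: cell_def of_nat_diff)
  qed
  show "cell p S T k = cell p S (insert u T) k \<union> ?R"
  proof (intro subset_antisym subsetI)
    fix x assume x: "x \<in> cell p S T k"
    show "x \<in> cell p S (insert u T) k \<union> ?R"
    proof (cases "lex_pos p S (x - u) u")
      case True
      from down[OF x True] show ?thesis by (auto intro!: image_eqI[of _ _ "x - u"])
    next
      case False
      then show ?thesis using x by (auto simp: cell_def)
    qed
  next
    fix x assume "x \<in> cell p S (insert u T) k \<union> ?R"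
    then show "x \<in> cell p S T k" using up by (auto simp: cell_def split: if_splits)
  qed
  show "cell p S (insert u T) k \<inter> ?R = {}"
  proof (cases "k = 0")
    case False
    have "x \<notin> (\<lambda>y. y + u) ` cell p S T (k - 1)" if "x \<in> cell p S (insert u T) k" for x
    proof
      assume "x \<in> (\<lambda>y. y + u) ` cell p S T (k - 1)"
      then show False using up[OF False] that by (auto simp: cell_def)
    qed
    then show ?thesis using False by auto
  qed simp
qed

section \<open>Generating functions of half-open cones and parallelepipeds\<close>

definition cell_series :: "'a \<Rightarrow> 'a set \<Rightarrow> 'a set \<Rightarrow> real fps" where
  "cell_series p S T = Abs_fps (\<lambda>k. real (card (cell p S T k)))"

text \<open>Multiplication by \<open>1 - fps_X\<close> subtracts the series shifted by one level,
  which removes exactly the translates found in \<open>cell_split\<close>.\<close>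

lemma cell_series_insert:
  assumes S: "basis_in V S" and T: "T \<subseteq> S" and u: "u \<in> S - T"
  shows "cell_series p S (insert u T) = (1 - fps_X) * cell_series p S T"
proof (rule fps_ext)
  fix k
  have "card (cell p S T k) = card (cell p S (insert u T) k) +
      card (if k = 0 then {} else (\<lambda>y. y + u) ` cell p S T (k - 1))"
    unfolding cell_split(1)[OF assms, of p k]
    by (rule card_Un_disjoint) (simp_all add: finite_cell[OF S] cell_split(2)[OF assms])
  also have "card (if k = 0 then {} else (\<lambda>y. y + u) ` cell p S T (k - 1)) =
      (if k = 0 then 0 else card (cell p S T (k - 1)))"
    by (simp add: card_image)
  finally show "cell_series p S (insert u T) $ k = ((1 - fps_X) * cell_series p S T) $ k"
    by (simp add: cell_series_def left_diff_distrib)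
qed

lemma cell_series_full:
  assumes S: "basis_in V S"
  shows "cell_series p S S = (1 - fps_X) ^ card S * cell_series p S {}"
proof -
  have "cell_series p S T = (1 - fps_X) ^ card T * cell_series p S {}" if "finite T" "T \<subseteq> S" for T
    using that
  proof (induction T)
    case (insert u T)
    then show ?case using cell_series_insert[OF S, of T u p] by (simp add: mult.assoc)
  qed simp
  from this[OF basis_inD(4)[OF S] subset_refl] show ?thesis .
qed

text \<open>In the parallelepiped every coordinate is at most one, so heights are bounded by the
  number of generators. This makes the numerator a polynomial.\<close>

lemma cell_full_empty:
  assumes S: "basis_in V S" and k: "card S < k"
  shows "cell p S S k = {}"
proof (rule ccontr)
  assume "cell p S S k \<noteq> {}"
  then obtain x where x: "x \<in> cell p S S k" by auto
  have xs: "x \<in> span V" using x by (simp add: cell_def)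
  have "representation S x u \<le> 1" if "u \<in> S" for u
  proof -
    have "\<not> lex_pos p S (x - u) u" using x that by (simp add: cell_def)
    then show ?thesis using representation_shift[OF S xs that that] by (auto simp: lex_pos_def)
  qed
  then have "h x \<le> real (card S)"
    unfolding height_eq_sum[OF S xs] using sum_bounded_above[of S "representation S x" 1] by simp
  then show False using x k by (simp add: cell_def)
qed

end

section \<open>The numerator of the level series and its leading coefficient\<close>

context lattice_cone
begin

definition level :: "nat \<Rightarrow> 'a set" where
  "level k = {x \<in> L. h x = real k \<and> x \<in> nonneg_combs V}"

text \<open>Existence and uniqueness of a lexicographically positive regular basis say that the
  half-open cones over the regular bases partition the closed cone.\<close>

lemma level_eq_cells:
  assumes g: "\<And>v. v \<in> V \<Longrightarrow> 0 < g v" and p: "p = (\<Sum>v\<in>V. g v *\<^sub>R v)"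
    and genp: "\<And>B u. basis_in V B \<Longrightarrow> u \<in> B \<Longrightarrow> representation B p u \<noteq> 0"
    and gen\<omega>: "\<And>B v. basis_in V B \<Longrightarrow> v \<in> V - B \<Longrightarrow> basis_cost \<omega> B v \<noteq> \<omega> v"
  shows "card (level k) = (\<Sum>S | regular_basis \<omega> V S. card (cell p S {} k))"
proof -
  let ?R = "{S. regular_basis \<omega> V S}"
  have fin: "finite ?R"
    by (rule finite_subset[of _ "Pow V"])
      (auto simp: regular_basis_def basis_in_def finite_V)
  have bas: "basis_in V S" if "S \<in> ?R" for S using that by (auto simp: regular_basis_def)
  have ps: "p \<in> span V" unfolding p by (intro span_sum span_scale span_base)
  have "level k \<subseteq> (\<Union>S\<in>?R. cell p S {} k)"
  proof
    fix x assume "x \<in> level k"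
    then obtain c where c: "\<And>v. v \<in> V \<Longrightarrow> 0 \<le> c v" and x: "x = (\<Sum>v\<in>V. c v *\<^sub>R v)"
      and xL: "x \<in> L" "h x = real k"
      by (auto simp: level_def nonneg_combs_def)
    have "x \<in> span V" unfolding x by (intro span_sum span_scale span_base)
    with regular_basis_lex_exists[OF finite_V linear_h h_V g p c x genp gen\<omega>] xL
    show "x \<in> (\<Union>S\<in>?R. cell p S {} k)" by (auto simp: cell_def)
  qed
  moreover have "cell p S {} k \<subseteq> level k" if "S \<in> ?R" for S
    using cell_subset[OF bas[OF that]] by (auto simp: level_def)
  ultimately have "level k = (\<Union>S\<in>?R. cell p S {} k)" by blast
  moreover have "card (\<Union>S\<in>?R. cell p S {} k) = (\<Sum>S\<in>?R. card (cell p S {} k))"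
  proof (intro card_UN_disjoint ballI impI fin finite_cell bas)
    fix S T assume ST: "S \<in> ?R" "T \<in> ?R" "S \<noteq> T"
    show "cell p S {} k \<inter> cell p T {} k = {}"
    proof (rule ccontr)
      assume "cell p S {} k \<inter> cell p T {} k \<noteq> {}"
      then obtain x where x: "x \<in> cell p S {} k" "x \<in> cell p T {} k" by blast
      have "S = T"
        by (rule regular_basis_lex_unique[of \<omega> V S T x p])
          (use ST x ps genp in \<open>auto simp: cell_def\<close>)
      then show False using ST by simp
    qed
  qed
  ultimately show ?thesis by simp
qed

text \<open>
  The point of the statement is \<open>\<Sum>S - z\<close>: reflection sends the half-open parallelepiped for the direction
  \<open>p\<close> to the one for \<open>-p\<close>, so that \<open>\<Sum>S - z\<close> stays in the cone after subtracting a small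
  multiple of the interior point \<open>p\<close>.
\<close>

lemma cell_reflect:
  assumes S: "basis_in V S" and z: "z \<in> cell p S S d"
    and g: "\<And>v. v \<in> V \<Longrightarrow> 0 < g v" and p: "p = (\<Sum>v\<in>V. g v *\<^sub>R v)"
  shows "\<exists>c. (\<forall>v\<in>V. 0 < c v) \<and> (\<Sum>v\<in>V. c v *\<^sub>R v) \<in> L \<and>
           (\<Sum>v\<in>V. c v) = real (card S) - real d"
proof -
  note b = basis_inD[OF S]
  have zs: "z \<in> span V" "z \<in> L" "h z = real d" using z by (auto simp: cell_def)
  have ps: "p \<in> span V" unfolding p by (intro span_sum span_scale span_base)
  let ?r = "representation S"
  have co: "?r z u < 1 \<or> (?r z u = 1 \<and> ?r p u \<le> 0)" if "u \<in> S" for u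
  proof -
    have "\<not> lex_pos p S (z - u) u" using z that by (simp add: cell_def)
    then show ?thesis using representation_shift[OF S zs(1) that that] by (auto simp: lex_pos_def)
  qed
  \<comment> \<open>These are the coordinates of \<open>\<Sum>S - z - e p\<close>. Where that of
    \<open>z\<close> is below one there is room for small \<open>e\<close>; where it equals one, the
    half-open condition makes the coordinate of \<open>p\<close> nonpositive.\<close>
  have "\<forall>\<^sub>F e in at_right 0. \<forall>u\<in>S. 0 \<le> 1 - ?r z u - e * ?r p u"
  proof (intro eventually_ball_finite b ballI)
    fix u assume u: "u \<in> S"
    show "\<forall>\<^sub>F e in at_right 0. 0 \<le> 1 - ?r z u - e * ?r p u"
    proof (cases "?r z u < 1")
      case True
      have "((\<lambda>e. 1 - ?r z u - e * ?r p u) \<longlongrightarrow> 1 - ?r z u) (at_right 0)"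
        by (auto intro!: tendsto_eq_intros)
      from order_tendstoD(1)[OF this, of 0] True show ?thesis
        by (auto elim: eventually_mono)
    next
      case False
      have "\<forall>\<^sub>F e in at_right (0::real). e > 0" by (rule eventually_at_right_less)
      then show ?thesis
        by eventually_elim (use False co[OF u] in \<open>auto simp: mult_nonneg_nonpos\<close>)
    qed
  qed
  moreover have "\<forall>\<^sub>F e in at_right (0::real). e > 0" by (rule eventually_at_right_less)
  ultimately have "\<forall>\<^sub>F e in at_right 0. e > 0 \<and> (\<forall>u\<in>S. 0 \<le> 1 - ?r z u - e * ?r p u)"
    by eventually_elim auto
  then obtain e where e: "e > 0" "\<And>u. u \<in> S \<Longrightarrow> 0 \<le> 1 - ?r z u - e * ?r p u"
    using eventually_happens'[OF trivial_limit_at_right_real] by blast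
  \<comment> \<open>The summand \<open>e * g v\<close> re-adds \<open>e p\<close> over all of
    \<open>V\<close> and makes every coefficient positive; the other summand expands
    \<open>\<Sum>S - z - e p\<close> over \<open>S\<close>.\<close>
  define c where "c v = e * g v + (if v \<in> S then 1 - ?r z v - e * ?r p v else 0)" for v
  have cpos: "\<forall>v\<in>V. 0 < c v"
    using e g by (auto simp: c_def add_pos_nonneg)
  have "(\<Sum>v\<in>V. c v *\<^sub>R v) = e *\<^sub>R p +
      (\<Sum>v\<in>V. (if v \<in> S then 1 - ?r z v - e * ?r p v else 0) *\<^sub>R v)"
    by (simp add: c_def p scaleR_left_distrib sum.distrib scaleR_sum_right)
  also have "(\<Sum>v\<in>V. (if v \<in> S then 1 - ?r z v - e * ?r p v else 0) *\<^sub>R v)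
      = (\<Sum>v\<in>S. (1 - ?r z v - e * ?r p v) *\<^sub>R v)"
    using b finite_V by (intro sum.mono_neutral_cong_right) auto
  also have "\<dots> = (\<Sum>v\<in>S. v) - (\<Sum>v\<in>S. ?r z v *\<^sub>R v) - e *\<^sub>R (\<Sum>v\<in>S. ?r p v *\<^sub>R v)"
    by (simp add: scaleR_left_diff_distrib sum_subtractf scaleR_sum_right)
  also have "\<dots> = (\<Sum>v\<in>S. v) - z - e *\<^sub>R p"
    using b zs ps by (simp add: sum_representation)
  finally have eq: "(\<Sum>v\<in>V. c v *\<^sub>R v) = (\<Sum>v\<in>S. v) - z" by simp
  have "(\<Sum>v\<in>S. v) - z \<in> L" using b V_subset zs by (intro diff_L sum_L) auto
  moreover have "(\<Sum>v\<in>V. c v) = real (card S) - real d"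
  proof -
    have "(\<Sum>v\<in>V. c v) = h (\<Sum>v\<in>V. c v *\<^sub>R v)"
      unfolding linear_lincomb[OF linear_h] using h_V by simp
    also have "\<dots> = (\<Sum>v\<in>S. h v) - h z"
      unfolding eq using linear_h by (simp add: linear_diff linear_sum)
    also have "(\<Sum>v\<in>S. h v) = real (card S)" using b h_V by (simp add: subset_iff)
    finally show ?thesis using zs by simp
  qed
  ultimately show ?thesis using cpos eq by auto
qed

text \<open>For fixed bases, the coordinates of the weighted sum are linear forms in
  \<open>g\<close>, and the defects \<open>\<omega> v - basis_cost \<omega> B v\<close> are linear
  forms in \<omega>. There are finitely many of them, all nonzero, so generic weights exist.\<close>

lemma generic_data:
  obtains g \<omega> :: "'a \<Rightarrow> real" where "\<And>v. 0 < g v"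
    "\<And>B u. basis_in V B \<Longrightarrow> u \<in> B \<Longrightarrow> representation B (\<Sum>v\<in>V. g v *\<^sub>R v) u \<noteq> 0"
    "\<And>B v. basis_in V B \<Longrightarrow> v \<in> V - B \<Longrightarrow> basis_cost \<omega> B v \<noteq> \<omega> v"
proof -
  let ?B = "{B. basis_in V B}"
  have finB: "finite ?B"
    by (rule finite_subset[of _ "Pow V"]) (auto simp: basis_in_def finite_V)
  define A1 where "A1 = (\<lambda>(B,u) v. representation B v u) ` Sigma ?B (\<lambda>B. B)"
  \<comment> \<open>Coefficients of the form \<open>\<omega> w - basis_cost \<omega> B w\<close>;
    the one at \<open>w\<close> is 1 because \<open>w\<close> lies outside \<open>B\<close>.\<close>
  define A2 where "A2 = (\<lambda>(B,w) v. (if v = w then 1 else 0) - (if v \<in> B then representation B w v else 0))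
      ` Sigma ?B (\<lambda>B. V - B)"
  have "\<exists>v\<in>V. a v \<noteq> 0" if "a \<in> A1" for a
  proof -
    obtain B u where "basis_in V B" "u \<in> B" "a = (\<lambda>v. representation B v u)"
      using \<open>a \<in> A1\<close> by (auto simp: A1_def)
    then show ?thesis using basis_inD[of B]
      by (intro bexI[of _ u]) (auto simp: real_vector.representation_basis)
  qed
  moreover have "finite A1" unfolding A1_def
    by (intro finite_imageI finite_SigmaI finB) (use basis_inD in auto)
  ultimately obtain g :: "'a \<Rightarrow> real" where g: "\<And>v. 0 < g v"
      "\<And>a. a \<in> A1 \<Longrightarrow> (\<Sum>v\<in>V. g v * a v) \<noteq> 0"
    using generic_positive_weights[OF finite_V, of A1] by metis
  have "\<exists>v\<in>V. a v \<noteq> 0" if "a \<in> A2" for a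
  proof -
    obtain B w where "basis_in V B" "w \<in> V - B"
      "a = (\<lambda>v. (if v = w then 1 else 0) - (if v \<in> B then representation B w v else 0))"
      using \<open>a \<in> A2\<close> by (auto simp: A2_def)
    then show ?thesis by (intro bexI[of _ w]) auto
  qed
  moreover have "finite A2" unfolding A2_def
    by (intro finite_imageI finite_SigmaI finB) (use finite_V in auto)
  ultimately obtain \<omega> :: "'a \<Rightarrow> real" where \<omega>: "\<And>v. 0 < \<omega> v"
      "\<And>a. a \<in> A2 \<Longrightarrow> (\<Sum>v\<in>V. \<omega> v * a v) \<noteq> 0"
    using generic_positive_weights[OF finite_V, of A2] by metis
  show ?thesis
  proof (rule that[of g \<omega>])
    show "representation B (\<Sum>v\<in>V. g v *\<^sub>R v) u \<noteq> 0" if B: "basis_in V B" "u \<in> B" for B u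
    proof -
      have "representation B (\<Sum>v\<in>V. g v *\<^sub>R v) u = (\<Sum>v\<in>V. g v * representation B v u)"
        using basis_inD[OF B(1)] by (intro representation_linear_comb) (auto intro: span_base)
      moreover have "(\<lambda>v. representation B v u) \<in> A1" using B by (auto simp: A1_def)
      ultimately show ?thesis using g(2) by metis
    qed
    show "basis_cost \<omega> B w \<noteq> \<omega> w" if B: "basis_in V B" "w \<in> V - B" for B w
    proof -
      let ?a = "\<lambda>v. (if v = w then 1 else 0) - (if v \<in> B then representation B w v else 0)"
      have "(\<Sum>v\<in>V. \<omega> v * ?a v) = (\<Sum>v\<in>V. if v = w then \<omega> w else 0)
          - (\<Sum>v\<in>V. if v \<in> B then representation B w v * \<omega> v else 0)"
        unfolding sum_subtractf[symmetric] by (intro sum.cong) (auto simp: algebra_simps)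
      also have "(\<Sum>v\<in>V. if v = w then \<omega> w else 0) = \<omega> w" using B finite_V by simp
      also have "(\<Sum>v\<in>V. if v \<in> B then representation B w v * \<omega> v else 0) = basis_cost \<omega> B w"
        unfolding basis_cost_def using basis_inD[OF B(1)] finite_V
        by (intro sum.mono_neutral_cong_right) auto
      finally have "(\<Sum>v\<in>V. \<omega> v * ?a v) = \<omega> w - basis_cost \<omega> B w" .
      moreover have "?a \<in> A2" using B by (auto simp: A2_def)
      ultimately show ?thesis using \<omega>(2)[of ?a] by linarith
    qed
  qed (rule g)
qed

text \<open>Adding the series of the half-open cones shows that the coefficients of \<open>q\<close>
  count the lattice points of all half-open parallelepipeds by height. A point counted by the
  leading coefficient is reflected by \<open>cell_reflect\<close>.\<close>

lemma level_series_numerator: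
  obtains q c where
    "fps_of_poly q = (1 - fps_X) ^ dim V * Abs_fps (\<lambda>k. real (card (level k)))"
    "\<And>v. v \<in> V \<Longrightarrow> 0 < c v" "(\<Sum>v\<in>V. c v *\<^sub>R v) \<in> L"
    "(\<Sum>v\<in>V. c v) = real (dim V) - real (degree q)"
proof -
  obtain g \<omega> :: "'a \<Rightarrow> real" where g: "\<And>v. 0 < g v"
    "\<And>B u. basis_in V B \<Longrightarrow> u \<in> B \<Longrightarrow> representation B (\<Sum>v\<in>V. g v *\<^sub>R v) u \<noteq> 0"
    "\<And>B v. basis_in V B \<Longrightarrow> v \<in> V - B \<Longrightarrow> basis_cost \<omega> B v \<noteq> \<omega> v"
    by (rule generic_data) blast
  define p where "p = (\<Sum>v\<in>V. g v *\<^sub>R v)"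
  let ?R = "{S. regular_basis \<omega> V S}"
  let ?E = "Abs_fps (\<lambda>k. real (card (level k)))"
  have bas: "basis_in V S" if "S \<in> ?R" for S using that by (auto simp: regular_basis_def)
  have cd: "card S = dim V" if "S \<in> ?R" for S
    using basis_inD[OF bas[OF that]] by (intro basis_card_eq_dim) (auto intro: span_base)
  have lev: "card (level k) = (\<Sum>S\<in>?R. card (cell p S {} k))" for k
    by (rule level_eq_cells[OF _ p_def]) (use g in \<open>auto simp: p_def\<close>)
  have E: "?E = (\<Sum>S\<in>?R. cell_series p S {})"
    by (rule fps_ext) (simp add: lev fps_sum_nth cell_series_def)
  define q where "q = (\<Sum>k\<le>dim V. monom (\<Sum>S\<in>?R. real (card (cell p S S k))) k)"
  have coeff_q: "coeff q k = (\<Sum>S\<in>?R. real (card (cell p S S k)))" for k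
  proof (cases "k \<le> dim V")
    case True
    then show ?thesis unfolding q_def coeff_sum by simp
  next
    case False
    then have "cell p S S k = {}" if "S \<in> ?R" for S
      using that cd bas by (intro cell_full_empty) auto
    with False show ?thesis unfolding q_def coeff_sum by simp
  qed
  have q: "fps_of_poly q = (1 - fps_X) ^ dim V * ?E"
  proof -
    have "fps_of_poly q = (\<Sum>S\<in>?R. cell_series p S S)"
      by (rule fps_ext) (simp add: coeff_q fps_sum_nth cell_series_def)
    also have "\<dots> = (\<Sum>S\<in>?R. (1 - fps_X) ^ dim V * cell_series p S {})"
      by (rule sum.cong) (use cell_series_full[OF bas] cd in auto)
    finally show ?thesis unfolding E by (simp add: sum_distrib_left)
  qed
  \<comment> \<open>The origin makes the level series nonzero; hence \<open>q\<close> has a nonzero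
    leading coefficient and some parallelepiped contains a point of height
    \<open>degree q\<close>.\<close>
  have "0 \<in> level 0"
    using zero_L linear_0[OF linear_h] by (auto simp: level_def nonneg_combs_def intro!: exI[of _ "\<lambda>_. 0"])
  then have "card (level 0) \<noteq> 0" using finite_level[of 0] by (auto simp: level_def)
  then have "?E \<noteq> 0" by (auto simp: fps_eq_iff)
  moreover have "(1 - fps_X :: real fps) \<noteq> 0"
    by (auto simp: fps_eq_iff intro: exI[of _ 0])
  ultimately have "fps_of_poly q \<noteq> 0" unfolding q by simp
  then have "q \<noteq> 0" by auto
  then have "coeff q (degree q) \<noteq> 0" by simp
  then obtain S where S: "S \<in> ?R" "card (cell p S S (degree q)) \<noteq> 0"
    unfolding coeff_q by (metis (mono_tags, lifting) of_nat_0 sum.neutral)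
  then obtain z where "z \<in> cell p S S (degree q)"
    by (metis all_not_in_conv card.empty)
  from cell_reflect[OF bas[OF S(1)] this _ p_def] g(1) cd[OF S(1)] obtain c
    where "\<forall>v\<in>V. 0 < c v" "(\<Sum>v\<in>V. c v *\<^sub>R v) \<in> L" "(\<Sum>v\<in>V. c v) = real (dim V) - real (degree q)"
    by auto
  with that[OF q] show ?thesis by blast
qed

end

subsection \<open>Lattice polytopes and their codegree\<close>

text \<open>The functionals embed the set into a finite product of bounded intervals of
  integers.\<close>

lemma finite_bounded_Int_if_integral_functionals:
  fixes L :: "'a::euclidean_space set" and G :: "('a \<Rightarrow> real) set"
  assumes "finite G" "bounded S"
    and lin: "\<And>f. f \<in> G \<Longrightarrow> linear f"
    and int: "\<And>f x. f \<in> G \<Longrightarrow> x \<in> L \<Longrightarrow> f x \<in> \<int>"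
    and inj: "\<And>x y. x \<in> L \<Longrightarrow> y \<in> L \<Longrightarrow> (\<And>f. f \<in> G \<Longrightarrow> f x = f y) \<Longrightarrow> x = y"
  shows "finite (S \<inter> L)"
proof -
  have "\<exists>N. \<forall>x\<in>S. \<bar>f x\<bar> \<le> N" if "f \<in> G" for f
  proof -
    have "bounded (f ` S)"
      using bounded_linear_image[OF assms(2)] lin[OF that] by (simp add: linear_conv_bounded_linear)
    then show ?thesis by (simp add: bounded_iff)
  qed
  then obtain N where N: "\<And>f x. f \<in> G \<Longrightarrow> x \<in> S \<Longrightarrow> \<bar>f x\<bar> \<le> N f" by metis
  let ?K = "\<lambda>f. {- \<lceil>N f\<rceil> .. \<lceil>N f\<rceil>}"
  let ?g = "\<lambda>x. restrict (\<lambda>f. \<lfloor>f x\<rfloor>) G"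
  have "?g ` (S \<inter> L) \<subseteq> PiE G ?K"
  proof clarify
    fix x assume x: "x \<in> S" "x \<in> L"
    show "?g x \<in> PiE G ?K"
    proof (rule restrict_PiE_iff[THEN iffD2], rule ballI)
      fix f assume f: "f \<in> G"
      show "\<lfloor>f x\<rfloor> \<in> ?K f" using N[OF f x(1)] by (simp add: abs_le_iff) linarith
    qed
  qed
  moreover have "finite (PiE G ?K)" using assms(1) by (intro finite_PiE) auto
  ultimately have "finite (?g ` (S \<inter> L))" by (rule finite_subset)
  moreover have "inj_on ?g (S \<inter> L)"
  proof (rule inj_onI)
    fix x y assume xy: "x \<in> S \<inter> L" "y \<in> S \<inter> L" "?g x = ?g y"
    show "x = y"
    proof (rule inj)
      fix f assume f: "f \<in> G"
      have "\<lfloor>f x\<rfloor> = \<lfloor>f y\<rfloor>" using fun_cong[OF xy(3), of f] f by simp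
      moreover have "f x \<in> \<int>" "f y \<in> \<int>" using int[OF f] xy by auto
      ultimately show "f x = f y" by (auto elim!: Ints_cases)
    qed (use xy in auto)
  qed
  ultimately show ?thesis by (rule finite_imageD)
qed

lemma group_closure_subset_span: "group_closure B \<subseteq> span B" for B :: "'a::real_vector set"
proof
  fix x assume "x \<in> group_closure B"
  then show "x \<in> span B"
    by induction (auto simp: span_diff span_base span_zero)
qed

lemma span_group_closure: "span (group_closure B) = span B" for B :: "'a::real_vector set"
proof
  show "span (group_closure B) \<subseteq> span B"
    by (rule span_minimal[OF group_closure_subset_span subspace_span])
  show "span B \<subseteq> span (group_closure B)"
    by (rule span_mono) (auto intro: group_closure.base)
qed

text \<open>The coordinate functionals of a lattice basis are integral on the lattice and separate
  its points.\<close>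

lemma zlattice_finite_bounded:
  assumes "zlattice L" "bounded S"
  shows "finite (S \<inter> L)"
proof -
  obtain B where B: "independent B" and L: "L = group_closure B"
    using assms by (auto simp: zlattice_def)
  have "\<exists>f. linear f \<and> (\<forall>x\<in>B. f x = (if x = b then 1 else 0::real))" for b
    by (rule linear_independent_extend[OF B])
  then obtain f where f: "\<And>b. linear (f b)"
      "\<And>b x. x \<in> B \<Longrightarrow> f b x = (if x = b then 1 else 0::real)" by metis
  have fin: "finite B" using B by (rule independent_imp_finite)
  show ?thesis
  proof (rule finite_bounded_Int_if_integral_functionals[of "f ` B"])
    fix h x assume "h \<in> f ` B" "x \<in> L"
    then obtain b where b: "b \<in> B" "h = f b" and x: "x \<in> group_closure B" by (auto simp: L)
    from x show "h x \<in> \<int>" unfolding b(2)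
      by induction (auto simp: f linear_diff[OF f(1)] linear_0[OF f(1)])
  next
    fix x y assume xy: "x \<in> L" "y \<in> L" and eq: "\<And>h. h \<in> f ` B \<Longrightarrow> h x = h y"
    let ?z = "x - y"
    have z: "?z \<in> span B" using xy group_closure_subset_span[of B] by (auto simp: L intro: span_diff)
    have "representation B ?z b = 0" if b: "b \<in> B" for b
    proof -
      have "0 = f b ?z" using eq[of "f b"] b by (simp add: linear_diff[OF f(1)])
      also have "\<dots> = f b (\<Sum>u\<in>B. representation B ?z u *\<^sub>R u)"
        using sum_representation[OF B z] by simp
      also have "\<dots> = (\<Sum>u\<in>B. if u = b then representation B ?z b else 0)"
        unfolding linear_lincomb[OF f(1)] using f(2) by (intro sum.cong) auto
      also have "\<dots> = representation B ?z b" using b fin by simp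
      finally show ?thesis by simp
    qed
    then have "?z = 0" using sum_representation[OF B z] by simp
    then show "x = y" by simp
  qed (use fin f assms in auto)
qed

lemma zlattice_zero_diff:
  assumes "zlattice L"
  shows "0 \<in> L" "\<And>x y. x \<in> L \<Longrightarrow> y \<in> L \<Longrightarrow> x - y \<in> L"
  using assms by (auto simp: zlattice_def intro: group_closure.diff)

lemma dual_lattice_ext_zero_diff:
  shows "0 \<in> dual_lattice_ext L"
    and "\<And>x y. x \<in> dual_lattice_ext L \<Longrightarrow> y \<in> dual_lattice_ext L \<Longrightarrow> x - y \<in> dual_lattice_ext L"
  by (auto simp: dual_lattice_ext_def dual_lattice_def zero_prod_def span_zero span_diff inner_diff_left)

text \<open>The pairings with a lattice basis and the last coordinate are integral on the extended
  dual lattice. They separate its points because a vector of \<open>span B\<close> orthogonal to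
  \<open>B\<close> is zero.\<close>

lemma dual_lattice_ext_finite_bounded:
  assumes "zlattice L" "bounded S"
  shows "finite (S \<inter> dual_lattice_ext L)"
proof -
  obtain B where B: "independent B" and L: "L = group_closure B"
    using assms by (auto simp: zlattice_def)
  have fin: "finite B" using B by (rule independent_imp_finite)
  have spn: "span L = span B" unfolding L by (rule span_group_closure)
  show ?thesis
  proof (rule finite_bounded_Int_if_integral_functionals[of "insert snd ((\<lambda>b y. fst y \<bullet> b) ` B)"])
    fix f :: "'a \<times> real \<Rightarrow> real" assume "f \<in> insert snd ((\<lambda>b y. fst y \<bullet> b) ` B)"
    then show "linear f"
      by (auto simp: linear_iff inner_add_left)
  next
    fix x y assume xy: "x \<in> dual_lattice_ext L" "y \<in> dual_lattice_ext L"
      and eq: "\<And>f. f \<in> insert snd ((\<lambda>b y. fst y \<bullet> b) ` B) \<Longrightarrow> f x = f y"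
    let ?z = "fst x - fst y"
    have z: "?z \<in> span B"
      using xy by (auto simp: dual_lattice_ext_def dual_lattice_def spn intro: span_diff)
    have orth: "orthogonal ?z b" if "b \<in> B" for b
      using eq[of "\<lambda>y. fst y \<bullet> b"] that by (auto simp: orthogonal_def inner_diff_left)
    have "orthogonal ?z ?z" by (rule orthogonal_to_span[OF z]) (rule orth)
    then have "fst x = fst y" by (simp add: orthogonal_def)
    moreover have "snd x = snd y" using eq by simp
    ultimately show "x = y" by (simp add: prod_eq_iff)
  qed (use fin assms in \<open>auto simp: dual_lattice_ext_def dual_lattice_def L intro: group_closure.base\<close>)
qed

section \<open>From a polytope to the cone over it\<close>

text \<open>Height zero is treated separately because \<open>dilate 0 {}\<close> is empty while the
  cone always contains the origin; this matches the constant term 1 in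
  \<open>ehrhart_series\<close>.\<close>

lemma nonneg_combs_height_one:
  fixes V :: "'a::euclidean_space set"
  assumes "finite V"
  shows "(y, real k) \<in> nonneg_combs (V \<times> {1}) \<longleftrightarrow>
    (if k = 0 then y = 0 else y \<in> dilate k (convex hull V))"
proof -
  have im: "V \<times> {1::real} = (\<lambda>v. (v, 1)) ` V" by auto
  have sum_im: "(\<Sum>v\<in>V \<times> {1::real}. c v *\<^sub>R v) = (\<Sum>v\<in>V. c (v, 1) *\<^sub>R v, \<Sum>v\<in>V. c (v, 1))" for c
    unfolding im by (subst sum.reindex) (auto simp: inj_on_def sum_prod)
  have "(y, real k) \<in> nonneg_combs (V \<times> {1}) \<longleftrightarrow>
     (\<exists>c. (\<forall>v\<in>V. 0 \<le> c v) \<and> y = (\<Sum>v\<in>V. c v *\<^sub>R v) \<and> real k = (\<Sum>v\<in>V. c v))" (is "?A \<longleftrightarrow> ?B")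
  proof
    assume ?A
    then obtain c where c: "(y, real k) = (\<Sum>v\<in>V \<times> {1}. c v *\<^sub>R v)" "\<forall>v\<in>V \<times> {1}. 0 \<le> c v"
      by (auto simp: nonneg_combs_def)
    show ?B
      by (rule exI[of _ "\<lambda>v. c (v, 1)"]) (use c in \<open>auto simp: sum_im\<close>)
  next
    assume ?B
    then obtain c where "\<forall>v\<in>V. 0 \<le> c v" "y = (\<Sum>v\<in>V. c v *\<^sub>R v)" "real k = (\<Sum>v\<in>V. c v)" by auto
    then have "(y, real k) = (\<Sum>v\<in>V \<times> {1}. c (fst v) *\<^sub>R v)" "\<forall>v\<in>V \<times> {1::real}. 0 \<le> c (fst v)"
      by (auto simp: sum_im[of "\<lambda>v. c (fst v)"])
    then show ?A unfolding nonneg_combs_def by (intro CollectI exI[of _ "\<lambda>v. c (fst v)"]) simp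
  qed
  also have "\<dots> \<longleftrightarrow> (if k = 0 then y = 0 else y \<in> dilate k (convex hull V))"
  proof (cases "k = 0")
    case True
    have "y = 0" if "\<forall>v\<in>V. 0 \<le> c v" "y = (\<Sum>v\<in>V. c v *\<^sub>R v)" "0 = (\<Sum>v\<in>V. c v)" for c
    proof -
      have "\<forall>v\<in>V. c v = 0" using that(1,3) assms by (metis sum_nonneg_eq_0_iff)
      then show ?thesis using that(2) by simp
    qed
    moreover have "\<exists>c. (\<forall>v\<in>V. 0 \<le> c v) \<and> 0 = (\<Sum>v\<in>V. c v *\<^sub>R v) \<and> (0::real) = (\<Sum>v\<in>V. c v)"
      by (rule exI[of _ "\<lambda>_. 0"]) simp
    ultimately show ?thesis using True by auto
  next
    case False
    show ?thesis (is "?l = ?r")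
    proof
      assume ?l
      then obtain c where c: "\<forall>v\<in>V. 0 \<le> c v" "y = (\<Sum>v\<in>V. c v *\<^sub>R v)" "real k = (\<Sum>v\<in>V. c v)" by auto
      have "(\<Sum>v\<in>V. (c v / k) *\<^sub>R v) \<in> convex hull V"
        unfolding convex_hull_finite[OF assms] using c False
        by (auto intro!: exI[of _ "\<lambda>v. c v / k"] simp: sum_divide_distrib[symmetric])
      moreover have "y = real k *\<^sub>R (\<Sum>v\<in>V. (c v / k) *\<^sub>R v)"
        using c(2) False by (simp add: scaleR_sum_right)
      ultimately show ?r using False by (auto simp: dilate_def)
    next
      assume ?r
      then obtain x where x: "x \<in> convex hull V" "y = real k *\<^sub>R x" using False by (auto simp: dilate_def)
      then obtain u where u: "\<forall>x\<in>V. 0 \<le> u x" "sum u V = 1" "(\<Sum>x\<in>V. u x *\<^sub>R x) = x"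
        unfolding convex_hull_finite[OF assms] by auto
      show ?l
        by (rule exI[of _ "\<lambda>v. real k * u v"])
          (use u x in \<open>auto simp: sum_distrib_left[symmetric] scaleR_sum_right\<close>)
    qed
  qed
  finally show ?thesis .
qed

text \<open>The affine hull at height one misses the origin, so adjoining the origin raises the
  affine dimension by one.\<close>

lemma dim_height_one: "int (dim (V \<times> {1::real})) = aff_dim V + 1"
  for V :: "'a::euclidean_space set"
proof -
  let ?V = "V \<times> {1::real}"
  have "affine {x :: 'a \<times> real. snd x = 1}"
    by (auto simp: affine_def)
  then have "affine hull ?V \<subseteq> {x. snd x = 1}" by (intro hull_minimal) auto
  then have "0 \<notin> affine hull ?V" by auto
  then have "aff_dim (insert 0 ?V) = aff_dim ?V + 1" by (simp add: aff_dim_insert)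
  moreover have "aff_dim (insert 0 ?V) = int (dim (insert 0 ?V))"
    by (rule aff_dim_zero) (simp add: hull_inc)
  moreover have "aff_dim ?V = aff_dim V"
  proof -
    have "?V = (+) (0, 1) ` ((\<lambda>x. (x, 0)) ` V)" by (auto simp: image_image)
    then have "aff_dim ?V = aff_dim ((\<lambda>x. (x, 0::real)) ` V)" by (simp add: aff_dim_translation_eq)
    also have "\<dots> = aff_dim V"
      by (rule aff_dim_injective_linear_image) (auto simp: linear_iff inj_on_def)
    finally show ?thesis .
  qed
  moreover have "dim (insert 0 ?V) = dim ?V"
    by (metis dim_span span_insert_0)
  ultimately show ?thesis by simp
qed

text \<open>The denominator has constant term 1 and is a unit among power series, so the numerator
  is unique and the description in \<open>hstar\<close> is resolved.\<close>

lemma hstar_eqI: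
  assumes "fps_of_poly q = (1 - fps_X) ^ nat (aff_dim Q + 1) * ehrhart_series L Q"
  shows "hstar L Q = q"
  unfolding hstar_def
proof (rule the_equality)
  let ?D = "(1 - fps_X :: real fps) ^ nat (aff_dim Q + 1)"
  have D0: "?D $ 0 = 1" by (simp add: fps_power_zeroth)
  then have D: "?D \<noteq> 0" by (metis fps_zero_nth zero_neq_one)
  show "ehrhart_series L Q = fps_of_poly q / ?D" unfolding assms by (rule nonzero_mult_div_cancel_left[OF D, symmetric])
  fix q' assume "ehrhart_series L Q = fps_of_poly q' / ?D"
  moreover have "?D dvd fps_of_poly q'"
    by (rule unit_imp_dvd) (simp only: fps_is_unit_iff D0 one_neq_zero not_False_eq_True)
  ultimately have "fps_of_poly q' = fps_of_poly q" unfolding assms by (metis dvd_mult_div_cancel)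
  then show "q' = q" by simp
qed

text \<open>In the cone over \<open>V \<times> {1}\<close> the level counts are the Ehrhart
  coefficients, so the numerator is \<open>hstar\<close> and the height
  \<open>dim ?V - degree q\<close> is the codegree. For \<open>V = {}\<close> all sums are zero, in
  agreement with the convention.\<close>

lemma codeg_interior_point:
  fixes L V :: "'a::euclidean_space set"
  assumes V: "finite V" "V \<subseteq> L"
    and L: "0 \<in> L" "\<And>x y. x \<in> L \<Longrightarrow> y \<in> L \<Longrightarrow> x - y \<in> L" "\<And>S. bounded S \<Longrightarrow> finite (S \<inter> L)"
  obtains c where "\<And>v. v \<in> V \<Longrightarrow> 0 < c v" "(\<Sum>v\<in>V. c v *\<^sub>R v) \<in> L"
    "(\<Sum>v\<in>V. c v) = of_int (codeg L (convex hull V))"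
proof -
  let ?V = "V \<times> {1::real}" and ?L = "L \<times> (\<int> :: real set)" and ?Q = "convex hull V"
  have im: "?V = (\<lambda>v. (v, 1)) ` V" by auto
  have lev: "{x \<in> ?L. snd x = real k \<and> x \<in> nonneg_combs ?V} =
      (\<lambda>y. (y, real k)) ` (if k = 0 then {0} else dilate k ?Q \<inter> L)" for k
    using nonneg_combs_height_one[OF V(1), of _ k] L(1) by (force split: if_splits)
  have findil: "finite (dilate k ?Q \<inter> L)" for k
    unfolding dilate_def
    by (intro L(3) bounded_scaling bounded_convex_hull finite_imp_bounded V)
  interpret lattice_cone ?V ?L snd
  proof (rule lattice_cone.intro)
    show "finite {x \<in> ?L. snd x = real k \<and> x \<in> nonneg_combs ?V}" for k
      unfolding lev using findil by simp
    show "linear (snd :: 'a \<times> real \<Rightarrow> real)" by (rule linear_snd)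
    show "0 \<in> ?L" using L(1) by (simp add: zero_prod_def)
    show "x - y \<in> ?L" if "x \<in> ?L" "y \<in> ?L" for x y
      using that L(2) by (cases x; cases y) simp
    show "finite ?V" using V(1) by simp
    show "?V \<subseteq> ?L" using V(2) by (intro Sigma_mono) auto
    show "snd v = 1" if "v \<in> ?V" for v using that by (cases v) simp
  qed
  obtain q c where q:
    "fps_of_poly q = (1 - fps_X) ^ dim ?V * Abs_fps (\<lambda>k. real (card (level k)))"
    and c: "\<And>v. v \<in> ?V \<Longrightarrow> 0 < c v" "(\<Sum>v\<in>?V. c v *\<^sub>R v) \<in> ?L"
    "(\<Sum>v\<in>?V. c v) = real (dim ?V) - real (degree q)"
    by (rule level_series_numerator) (rule that)
  have cl: "card (level k) = (if k = 0 then 1 else card (dilate k ?Q \<inter> L))" for k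
    unfolding level_def lev by (simp add: card_image inj_on_def)
  have E: "Abs_fps (\<lambda>k. real (card (level k))) = ehrhart_series L ?Q"
    unfolding ehrhart_series_def cl by (rule arg_cong[of _ _ Abs_fps]) auto
  have d: "int (dim ?V) = aff_dim ?Q + 1" by (simp add: dim_height_one aff_dim_convex_hull)
  then have "nat (aff_dim ?Q + 1) = dim ?V" by simp
  with q have "hstar L ?Q = q" by (intro hstar_eqI) (simp add: E)
  then have cod: "real_of_int (codeg L ?Q) = real (dim ?V) - real (degree q)"
    using d by (simp add: codeg_def)
  show ?thesis
  proof (rule that[of "\<lambda>v. c (v, 1)"])
    have inj: "inj_on (\<lambda>v. (v, 1::real)) V" by (simp add: inj_on_def)
    have "(\<Sum>v\<in>?V. c v *\<^sub>R v) = (\<Sum>v\<in>V. c (v, 1) *\<^sub>R v, \<Sum>v\<in>V. c (v, 1))"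
      unfolding im by (simp add: sum.reindex[OF inj] sum_prod)
    then show "(\<Sum>v\<in>V. c (v, 1) *\<^sub>R v) \<in> L" using c(2) by simp
    have "(\<Sum>v\<in>?V. c v) = (\<Sum>v\<in>V. c (v, 1))"
      unfolding im by (simp add: sum.reindex[OF inj])
    then show "(\<Sum>v\<in>V. c (v, 1)) = of_int (codeg L ?Q)" using c(3) cod by linarith
    show "0 < c (v, 1)" if "v \<in> V" for v using c(1)[of "(v, 1)"] that by simp
  qed
qed

subsection \<open>Facet normals of Gorenstein polytopes\<close>

lemma convex_cone_nonneg_combs:
  "convex_cone (nonneg_combs W)"
  unfolding convex_cone_iff
proof (intro conjI ballI allI impI)
  show "0 \<in> nonneg_combs W"
    by (auto simp: nonneg_combs_def intro!: exI[of _ "\<lambda>_. 0"])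
  fix x assume "x \<in> nonneg_combs W"
  then obtain c where c: "\<forall>w\<in>W. 0 \<le> c w" "x = (\<Sum>w\<in>W. c w *\<^sub>R w)" by (auto simp: nonneg_combs_def)
  show "a *\<^sub>R x \<in> nonneg_combs W" if "0 \<le> a" for a
    unfolding nonneg_combs_def
    by (intro CollectI exI[of _ "\<lambda>w. a * c w"]) (use c that in \<open>auto simp: scaleR_sum_right\<close>)
  fix y assume "y \<in> nonneg_combs W"
  then obtain d where d: "\<forall>w\<in>W. 0 \<le> d w" "y = (\<Sum>w\<in>W. d w *\<^sub>R w)" by (auto simp: nonneg_combs_def)
  show "x + y \<in> nonneg_combs W"
    unfolding nonneg_combs_def
    by (intro CollectI exI[of _ "\<lambda>w. c w + d w"]) (use c d in \<open>auto simp: scaleR_left_distrib sum.distrib\<close>)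
qed

text \<open>The finitely generated cone is closed, so a hyperplane separates it from
  \<open>y\<close> at a level \<open>b < 0\<close>. A generator with negative value could be scaled
  to reach the level \<open>b\<close>, so all generators have nonnegative value.\<close>

lemma farkas_nonneg_combs:
  fixes W :: "'a::euclidean_space set"
  assumes "finite W" "y \<notin> nonneg_combs W"
  obtains a where "a \<bullet> y < 0" "\<And>w. w \<in> W \<Longrightarrow> 0 \<le> a \<bullet> w"
proof -
  let ?C = "convex_cone hull W"
  have gen: "w \<in> nonneg_combs W" if "w \<in> W" for w
    unfolding nonneg_combs_def
    by (intro CollectI exI[of _ "\<lambda>v. if v = w then 1 else 0"])
      (use that assms(1) in \<open>auto simp: if_distrib[of "\<lambda>c. c *\<^sub>R _"] cong: if_cong\<close>)
  have "?C \<subseteq> nonneg_combs W" by (rule hull_minimal) (auto simp: gen convex_cone_nonneg_combs)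
  then have "y \<notin> ?C" using assms(2) by auto
  from separating_hyperplane_closed_point[OF convex_convex_cone_hull closed_convex_cone_hull[OF assms(1)] this]
  obtain a b where ab: "a \<bullet> y < b" "\<And>x. x \<in> ?C \<Longrightarrow> b < a \<bullet> x"
    by auto
  have b: "b < 0" using ab(2)[OF convex_cone_hull_contains_0] by simp
  have "0 \<le> a \<bullet> w" if w: "w \<in> W" for w
  proof (rule ccontr)
    assume "\<not> 0 \<le> a \<bullet> w"
    then have neg: "a \<bullet> w < 0" by simp
    have "(b / (a \<bullet> w)) *\<^sub>R w \<in> ?C"
      using neg b w by (intro convex_cone_hull_mul hull_inc) (auto simp: divide_nonpos_neg)
    from ab(2)[OF this] neg show False by simp
  qed
  with ab b show ?thesis by (intro that[of a]) auto
qed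

lemma gorenstein_pointD:
  assumes "gorenstein M r P"
  defines "m \<equiv> gorenstein_point M r P"
  shows "rel_interior (dilate r P) \<inter> M = {m}"
    and "reflexive_polytope M ((\<lambda>x. x - m) ` dilate r P)"
proof -
  obtain m' where m': "rel_interior (dilate r P) \<inter> M = {m'}"
     "reflexive_polytope M ((\<lambda>x. x - m') ` dilate r P)"
    using assms by (auto simp: gorenstein_def)
  have "m = m'" unfolding m_def gorenstein_point_def
    by (rule the_equality) (use m' in auto)
  with m' show "rel_interior (dilate r P) \<inter> M = {m}"
    "reflexive_polytope M ((\<lambda>x. x - m) ` dilate r P)" by auto
qed

text \<open>The sign of the primitive normal is chosen so that the facet lies at level -1. A point
  of \<open>Q\<close> beyond this level would put the facet strictly between itself and 0, and the
  face property would then pull 0 into the facet.\<close>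

lemma reflexive_facet_normal:
  assumes Q: "reflexive_polytope M Q" and G: "G facet_of Q"
  obtains n where "n \<in> dual_lattice M" "affine hull G = {y \<in> span M. n \<bullet> y = -1}"
    "\<And>y. y \<in> Q \<Longrightarrow> -1 \<le> n \<bullet> y"
proof -
  obtain u c where u: "primitive_in (dual_lattice M) u" "affine hull G = {y \<in> span M. u \<bullet> y = c}"
    "1 = \<bar>u \<bullet> 0 - c\<bar>"
    using assms by (auto simp: reflexive_polytope_def integral_distance_def)
  have c: "c = 1 \<or> c = -1" using u(3) by auto
  define n where "n = (- c) *\<^sub>R u"
  have uD: "u \<in> dual_lattice M" using u(1) by (simp add: primitive_in_def)
  then have "- u \<in> dual_lattice M"
    by (auto simp: dual_lattice_def span_neg)
  with uD have nD: "n \<in> dual_lattice M" using c by (auto simp: n_def)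
  have aff: "affine hull G = {y \<in> span M. n \<bullet> y = -1}"
    unfolding u(2) n_def using c by (auto simp: inner_scaleR_left)
  obtain V where V: "finite V" "V \<subseteq> M" "Q = convex hull V"
    using Q by (auto simp: reflexive_polytope_def lattice_polytope_def)
  have cvx: "convex Q" unfolding V(3) by (rule convex_convex_hull)
  have sub: "Q \<subseteq> span M" unfolding V(3)
    by (intro hull_minimal subspace_imp_convex subspace_span) (use V(2) span_base in blast)
  have 0: "0 \<in> Q" using Q rel_interior_subset by (auto simp: reflexive_polytope_def)
  have face: "G face_of Q" using G by (simp add: facet_of_def)
  have "-1 \<le> n \<bullet> y" if y: "y \<in> Q" for y
  proof (rule ccontr)
    assume "\<not> -1 \<le> n \<bullet> y"
    then have ny: "n \<bullet> y < -1" by simp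
    \<comment> \<open>\<open>t *\<^sub>R y\<close> is the point where the segment from 0 to
      \<open>y\<close> crosses the facet hyperplane.\<close>
    define t where "t = - 1 / (n \<bullet> y)"
    have t: "0 < t" "t < 1" using ny by (auto simp: t_def field_simps)
    have z: "t *\<^sub>R y \<in> open_segment 0 y"
      using t ny by (auto simp: in_segment intro!: exI[of _ t])
    have "t *\<^sub>R y \<in> Q"
      using convexD_alt[OF cvx 0 y, of t] t by simp
    moreover have "t *\<^sub>R y \<in> affine hull G"
      unfolding aff using y sub ny span_scale[of y M t] by (auto simp: t_def)
    ultimately have "t *\<^sub>R y \<in> G" using face_of_imp_eq_affine_Int[OF cvx face] by auto
    then have "0 \<in> G" using face_ofD[OF face z 0 y] by simp
    then have "0 \<in> affine hull G" by (rule hull_inc)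
    then show False unfolding aff by simp
  qed
  with that nD aff show ?thesis by blast
qed

text \<open>\<open>W\<close> consists of the facet normals of \<open>r P - m\<close>, lifted to
  affine functions on \<open>P\<close>. By Farkas it suffices that a functional nonnegative on
  \<open>W\<close> acts, on vectors with first component in \<open>span M\<close>, as a nonnegative
  multiple of some \<open>(x, 1)\<close> with \<open>x \<in> P\<close>.\<close>

lemma gorenstein_dual_cone_generators:
  assumes gor: "gorenstein M r P"
  defines "m \<equiv> gorenstein_point M r P"
  obtains W where "finite W" "W \<subseteq> dual_lattice_ext M"
    "\<And>w. w \<in> W \<Longrightarrow> w \<bullet> (m, real r) = 1"
    "\<And>w x. w \<in> W \<Longrightarrow> x \<in> P \<Longrightarrow> 0 \<le> w \<bullet> (x, 1)"
    "\<And>y. fst y \<in> span M \<Longrightarrow> (\<And>x. x \<in> P \<Longrightarrow> 0 \<le> y \<bullet> (x, 1)) \<Longrightarrow> y \<in> nonneg_combs W"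
proof -
  define Q where "Q = (\<lambda>x. x - m) ` dilate r P"
  have r: "r > 0" and r1: "dim M = 0 \<Longrightarrow> r = 1"
    using gor by (auto simp: gorenstein_def)
  obtain V where V: "finite V" "V \<subseteq> M" "P = convex hull V"
    using gor by (auto simp: gorenstein_def lattice_polytope_def)
  have m: "rel_interior (dilate r P) \<inter> M = {m}" and refl: "reflexive_polytope M Q"
    using gorenstein_pointD[OF gor] by (auto simp: m_def Q_def)
  have mM: "m \<in> M" using m by auto
  have "m \<in> dilate r P" using m rel_interior_subset by blast
  then obtain x0 where x0: "x0 \<in> P" "m = real r *\<^sub>R x0" by (auto simp: dilate_def)
  have Qeq: "Q = (\<lambda>x. - m + real r *\<^sub>R x) ` P"
    by (simp add: Q_def dilate_def image_image)
  then have Qhull: "Q = convex hull ((\<lambda>x. - m + real r *\<^sub>R x) ` V)"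
    unfolding V(3) convex_hull_affinity .
  have polyt: "polytope Q" unfolding Qhull polytope_def using V(1) by blast
  then have poly: "polyhedron Q" and bdd: "bounded Q" and cvx: "convex Q"
    by (auto simp: polytope_imp_polyhedron polytope_imp_bounded polytope_imp_convex)
  have Psub: "P \<subseteq> span M" unfolding V(3)
    by (intro hull_minimal subspace_imp_convex subspace_span) (use V(2) span_base in blast)
  have Qsub: "Q \<subseteq> span M"
    unfolding Qeq using Psub span_base[OF mM] by (auto intro!: span_diff span_scale)
  have z: "0 \<in> rel_interior Q" and dimQ: "aff_dim Q = int (dim M)"
    using refl by (auto simp: reflexive_polytope_def)
  have 0: "0 \<in> Q" using z rel_interior_subset by blast
  have affQ: "affine hull Q = span M"
  proof -
    have h0: "0 \<in> affine hull Q" using 0 by (rule hull_inc)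
    have "int (dim Q) = int (dim M)" using aff_dim_zero[OF h0] dimQ by simp
    then have "span Q = span (span M)" using Qsub by (intro dim_eq_span) (simp_all add: dim_span)
    then show ?thesis using affine_hull_span_0[OF h0] by (simp add: span_span)
  qed
  have "\<exists>n. n \<in> dual_lattice M \<and> affine hull G = {y \<in> span M. n \<bullet> y = -1} \<and> (\<forall>y\<in>Q. -1 \<le> n \<bullet> y)"
    if "G facet_of Q" for G
    using reflexive_facet_normal[OF refl that] by metis
  then obtain N where N: "\<And>G. G facet_of Q \<Longrightarrow> N G \<in> dual_lattice M"
     "\<And>G. G facet_of Q \<Longrightarrow> affine hull G = {y \<in> span M. N G \<bullet> y = -1}"
     "\<And>G y. G facet_of Q \<Longrightarrow> y \<in> Q \<Longrightarrow> -1 \<le> N G \<bullet> y" by metis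
  \<comment> \<open>The last entry makes the pairing with \<open>(m, real r)\<close> equal to 1; at
    \<open>(x, 1)\<close> the value is \<open>(N G \<bullet> (r x - m) + 1) / r\<close>, which is
    nonnegative for \<open>x\<close> in \<open>P\<close>.\<close>
  define nrm where "nrm G = (N G, (1 - N G \<bullet> m) / real r)" for G
  \<comment> \<open>In rank 0 there are no facets and the ray of \<open>(0, 1)\<close> has to be
    supplied; its pairing with \<open>(m, real r)\<close> is 1 because then
    \<open>r = 1\<close>.\<close>
  define W where "W = nrm ` {G. G facet_of Q} \<union> (if dim M = 0 then {(0, 1)} else {})"
  have nrm_at: "nrm G \<bullet> (a, b) = (N G \<bullet> (real r *\<^sub>R a - b *\<^sub>R m) + b) / real r" for G a b
    using r by (simp add: nrm_def inner_diff_right field_simps)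
  have finW: "finite W" using finite_polyhedron_facets[OF poly] by (simp add: W_def)
  have Wne: "W \<noteq> {}"
  proof (cases "dim M = 0")
    case False
    then have "0 < aff_dim Q" unfolding dimQ by linarith
    then obtain G where "G facet_of Q" using polytope_facet_exists[OF polyt] by metis
    then show ?thesis by (auto simp: W_def)
  qed (simp add: W_def)
  have Wdual: "W \<subseteq> dual_lattice_ext M"
  proof
    fix w assume "w \<in> W"
    then consider G where "G facet_of Q" "w = nrm G" | "w = (0, 1)" by (auto simp: W_def split: if_splits)
    then show "w \<in> dual_lattice_ext M"
    proof cases
      case (1 G)
      have face: "G face_of Q" and Gne: "G \<noteq> {}" using 1(1) by (auto simp: facet_of_def)
      \<comment> \<open>The facet contains some \<open>r v - m\<close> with
        \<open>v \<in> V\<close>. Since \<open>N G\<close> has value -1 there, the last entry of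
        \<open>nrm G\<close> is the integer \<open>- (N G \<bullet> v)\<close>.\<close>
      have "compact ((\<lambda>x. - m + real r *\<^sub>R x) ` V)" using V(1) by (simp add: finite_imp_compact)
      from face_of_convex_hull_subset[OF this face[unfolded Qhull]]
      obtain S' where S': "S' \<subseteq> (\<lambda>x. - m + real r *\<^sub>R x) ` V" "G = convex hull S'" .
      then obtain v where v: "v \<in> V" "- m + real r *\<^sub>R v \<in> S'" using Gne by auto
      then have "- m + real r *\<^sub>R v \<in> affine hull G" using S' by (auto intro!: hull_inc)
      then have "N G \<bullet> (- m + real r *\<^sub>R v) = -1" using N(2)[OF 1(1)] by simp
      then have "(1 - N G \<bullet> m) / real r = - (N G \<bullet> v)"
        using r by (simp add: inner_diff_right field_simps)
      moreover have "N G \<bullet> v \<in> \<int>" using N(1)[OF 1(1)] v V(2) by (auto simp: dual_lattice_def)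
      ultimately show ?thesis using N(1)[OF 1(1)] by (simp add: 1 nrm_def dual_lattice_ext_def)
    next
      case 2
      then show ?thesis by (simp add: dual_lattice_ext_def dual_lattice_def span_zero)
    qed
  qed
  have W1: "w \<bullet> (m, real r) = 1" if w: "w \<in> W" for w
  proof -
    consider G where "w = nrm G" | "w = (0, 1)" "r = 1"
      using w r1 by (auto simp: W_def split: if_splits)
    then show ?thesis by cases (use r in \<open>simp_all add: nrm_at\<close>)
  qed
  have Wpos: "0 \<le> w \<bullet> (x, 1)" if w: "w \<in> W" and x: "x \<in> P" for w x
  proof -
    consider G where "G facet_of Q" "w = nrm G" | "w = (0, 1)"
      using w by (auto simp: W_def split: if_splits)
    then show ?thesis
    proof cases
      case (1 G)
      have "real r *\<^sub>R x - 1 *\<^sub>R m \<in> Q" using x by (auto simp: Qeq)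
      from N(3)[OF 1(1) this] show ?thesis unfolding 1(2) nrm_at using r by simp
    qed simp
  qed
  have Wcone: "y \<in> nonneg_combs W"
    if y1: "fst y \<in> span M" and y: "\<And>x. x \<in> P \<Longrightarrow> 0 \<le> y \<bullet> (x, 1)" for y
  proof (rule ccontr)
    assume "y \<notin> nonneg_combs W"
    from farkas_nonneg_combs[OF finW this]
    obtain a where a: "a \<bullet> y < 0" "\<And>w. w \<in> W \<Longrightarrow> 0 \<le> a \<bullet> w" by auto
    \<comment> \<open>\<open>y\<close> and all of \<open>W\<close> have first component in
      \<open>span M\<close>, so only the projection of \<open>a\<close> matters for the
      pairings.\<close>
    obtain a1 a2 where a12: "a1 \<in> span M" "\<And>w. w \<in> span M \<Longrightarrow> orthogonal a2 w" "fst a = a1 + a2"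
      by (rule orthogonal_subspace_decomp_exists[of M "fst a"]) auto
    define s where "s = snd a"
    have a_at: "a \<bullet> u = u \<bullet> (a1, s)" if "fst u \<in> span M" for u
      using a12(2)[OF that]
      by (cases a; cases u) (use a12(3) in \<open>simp add: s_def inner_add_right orthogonal_def inner_commute\<close>)
    have W_at: "0 \<le> w \<bullet> (a1, s)" if "w \<in> W" for w
    proof -
      have "fst w \<in> span M" using that Wdual by (auto simp: dual_lattice_ext_def dual_lattice_def)
      then show ?thesis using a(2)[OF that] a_at by simp
    qed
    \<comment> \<open>For \<open>s > 0\<close>, the point \<open>a1 / s\<close> lies in
      \<open>P\<close> exactly if \<open>q / s\<close> lies in \<open>Q\<close>. If
      \<open>q = 0\<close>, then \<open>(a1, s)\<close> is a multiple of \<open>(m, real r)\<close>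
      and any element of \<open>W\<close> fixes the sign.\<close>
    define q where "q = real r *\<^sub>R a1 - s *\<^sub>R m"
    have qM: "q \<in> span M" unfolding q_def
      using a12(1) span_base[OF mM] by (intro span_diff span_scale)
    have "\<exists>x\<in>P. s \<ge> 0 \<and> a1 = s *\<^sub>R x"
    proof (cases "q = 0")
      case True
      then have "real r *\<^sub>R a1 = real r *\<^sub>R (s *\<^sub>R x0)" by (simp add: q_def x0(2) mult.commute)
      then have a1: "a1 = s *\<^sub>R x0" using r unfolding scaleR_cancel_left by simp
      then have pt: "(a1, s) = (s / real r) *\<^sub>R (m, real r)" using r by (simp add: x0(2))
      obtain w where w: "w \<in> W" using Wne by auto
      have "0 \<le> (s / real r) * (w \<bullet> (m, real r))"
        using W_at[OF w] unfolding pt inner_scaleR_right .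
      then have "0 \<le> s" using r W1[OF w] by (simp add: zero_le_divide_iff)
      then show ?thesis using x0(1) a1 by blast
    next
      case False
      \<comment> \<open>The ray through \<open>q\<close> leaves \<open>Q\<close> at
        \<open>d q\<close> in some facet \<open>G\<close>. Nonnegativity of \<open>nrm G\<close> at
        \<open>(a1, s)\<close> gives \<open>1 / d \<le> s\<close>, so \<open>q / s\<close> comes no
        later on the ray and lies in \<open>Q\<close>.\<close>
      obtain d where d: "0 < d" "0 + d *\<^sub>R q \<in> rel_frontier Q"
        by (rule ray_to_rel_frontier[OF bdd z _ False]) (use qM affQ in auto)
      then obtain G where G: "G facet_of Q" "d *\<^sub>R q \<in> G"
        unfolding rel_frontier_of_polyhedron[OF poly] by auto
      have dq: "d *\<^sub>R q \<in> Q" using G facet_of_imp_subset by blast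
      have "d *\<^sub>R q \<in> affine hull G" using G(2) by (rule hull_inc)
      then have "d * (N G \<bullet> q) = -1" using N(2)[OF G(1)] by simp
      then have Nq: "N G \<bullet> q = - 1 / d" using d(1) by (simp add: field_simps)
      have "0 \<le> nrm G \<bullet> (a1, s)" by (rule W_at) (use G(1) in \<open>auto simp: W_def\<close>)
      then have "0 \<le> - 1 / d + s" using r unfolding nrm_at q_def[symmetric] Nq
        by (simp add: zero_le_divide_iff)
      then have sd: "1 / d \<le> s" by simp
      moreover have "0 < 1 / d" using d(1) by simp
      ultimately have s0: "0 < s" by linarith
      have "1 / (s * d) \<le> 1" using sd s0 d(1) by (simp add: field_simps)
      then have "(1 / (s * d)) *\<^sub>R (d *\<^sub>R q) \<in> Q"
        using convexD_alt[OF cvx 0 dq, of "1 / (s * d)"] s0 d(1) by simp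
      moreover have "(1 / (s * d)) *\<^sub>R (d *\<^sub>R q) = (1 / s) *\<^sub>R q" using d(1) by simp
      ultimately obtain x where x: "x \<in> P" "(1 / s) *\<^sub>R q = - m + real r *\<^sub>R x"
        by (auto simp: Qeq)
      then have "s *\<^sub>R ((1 / s) *\<^sub>R q) = s *\<^sub>R (- m + real r *\<^sub>R x)" by simp
      then have "q = - s *\<^sub>R m + real r *\<^sub>R (s *\<^sub>R x)" using s0 by (simp add: algebra_simps)
      then have "real r *\<^sub>R a1 = real r *\<^sub>R (s *\<^sub>R x)" by (simp add: q_def)
      then have "a1 = s *\<^sub>R x" using r unfolding scaleR_cancel_left by simp
      then show ?thesis using x(1) s0 by (intro bexI[of _ x]) auto
    qed
    then obtain x where x: "x \<in> P" "s \<ge> 0" "(a1, s) = s *\<^sub>R (x, 1)" by auto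
    have "a \<bullet> y = s * (y \<bullet> (x, 1))" using a_at[OF y1] unfolding x(3) inner_scaleR_right .
    then show False using a(1) y[OF x(1)] x(2) by (simp add: mult_less_0_iff)
  qed
  show ?thesis using that[OF finW Wdual W1 Wpos Wcone] .
qed

text \<open>An element of the dual face is a nonnegative combination of \<open>W\<close>. Vanishing
  on \<open>F\<close> kills the coefficients of generators that do not vanish on \<open>F\<close>,
  and the pairing with the Gorenstein point makes the rest sum to one.\<close>

lemma dual_face_eq_hull:
  assumes F: "F \<subseteq> P"
    and W: "finite W" "W \<subseteq> dual_lattice_ext M"
    "\<And>w. w \<in> W \<Longrightarrow> w \<bullet> (gorenstein_point M r P, real r) = 1"
    "\<And>w x. w \<in> W \<Longrightarrow> x \<in> P \<Longrightarrow> 0 \<le> w \<bullet> (x, 1)"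
    "\<And>y. fst y \<in> span M \<Longrightarrow> (\<And>x. x \<in> P \<Longrightarrow> 0 \<le> y \<bullet> (x, 1)) \<Longrightarrow> y \<in> nonneg_combs W"
  shows "dual_face M r P F = convex hull {w \<in> W. \<forall>x\<in>F. w \<bullet> (x, 1) = 0}"
proof -
  let ?n = "(gorenstein_point M r P, real r)"
  define U where "U = {w \<in> W. \<forall>x\<in>F. w \<bullet> (x, 1) = 0}"
  have U: "finite U" "U \<subseteq> W" using W(1) by (auto simp: U_def)
  have "dual_face M r P F = convex hull U"
  proof (intro subset_antisym subsetI)
    fix y assume y: "y \<in> dual_face M r P F"
    then have yn: "y \<bullet> ?n = 1" and yF: "\<And>x. x \<in> F \<Longrightarrow> y \<bullet> (x, 1) = 0"
      and ysp: "y \<in> span (dual_lattice_ext M)" and yc: "\<And>x. x \<in> cone_over P \<Longrightarrow> 0 \<le> y \<bullet> x"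
      by (auto simp: dual_face_def dual_gorenstein_def dual_cone_def)
    have "span (dual_lattice_ext M) \<subseteq> span M \<times> UNIV"
      by (intro span_minimal subspace_Times subspace_span subspace_UNIV)
        (auto simp: dual_lattice_ext_def dual_lattice_def)
    then have y1: "fst y \<in> span M" using ysp by auto
    have "0 \<le> y \<bullet> (x, 1)" if "x \<in> P" for x
      by (rule yc) (use that in \<open>auto simp: cone_over_def intro: hull_inc\<close>)
    from W(5)[OF y1 this] obtain c where c: "\<And>w. w \<in> W \<Longrightarrow> 0 \<le> c w"
      and yc: "y = (\<Sum>w\<in>W. c w *\<^sub>R w)" by (auto simp: nonneg_combs_def)
    have y_at: "y \<bullet> z = (\<Sum>w\<in>W. c w * (w \<bullet> z))" for z
      by (simp add: yc inner_sum_left)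
    have c0: "c w = 0" if w: "w \<in> W - U" for w
    proof -
      obtain x where x: "x \<in> F" "w \<bullet> (x, 1) \<noteq> 0" using w by (auto simp: U_def)
      have "(\<Sum>w\<in>W. c w * (w \<bullet> (x, 1))) = 0" using yF[OF x(1)] by (simp add: y_at)
      then have "c w * (w \<bullet> (x, 1)) = 0"
        using w x(1) F W(1) c W(4) by (subst (asm) sum_nonneg_eq_0_iff) auto
      then show ?thesis using x(2) by simp
    qed
    have "y = (\<Sum>w\<in>U. c w *\<^sub>R w)"
      unfolding yc using W(1) U c0 by (intro sum.mono_neutral_right) auto
    moreover have "sum c U = 1"
    proof -
      have "sum c U = sum c W" using W(1) U c0 by (intro sum.mono_neutral_left) auto
      also have "\<dots> = (\<Sum>w\<in>W. c w * (w \<bullet> ?n))" by (intro sum.cong) (simp_all add: W(3))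
      also have "\<dots> = 1" using yn y_at by simp
      finally show ?thesis .
    qed
    ultimately show "y \<in> convex hull U"
      unfolding convex_hull_finite[OF U(1)] using c U(2)
      by (intro CollectI exI[of _ c]) auto
  next
    fix y assume "y \<in> convex hull U"
    then obtain c where c: "\<forall>w\<in>U. 0 \<le> c w" "sum c U = 1" "(\<Sum>w\<in>U. c w *\<^sub>R w) = y"
      unfolding convex_hull_finite[OF U(1)] by auto
    have y_at: "y \<bullet> z = (\<Sum>w\<in>U. c w * (w \<bullet> z))" for z
      unfolding c(3)[symmetric] by (simp add: inner_sum_left)
    have "y \<in> span (dual_lattice_ext M)" unfolding c(3)[symmetric]
      using U(2) W(2) by (intro span_sum span_scale span_base) auto
    moreover have "0 \<le> y \<bullet> x" if "x \<in> cone_over P" for x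
    proof -
      have "cone_over P \<subseteq> {x. 0 \<le> y \<bullet> x}" unfolding cone_over_def
      proof (rule hull_minimal)
        show "P \<times> {1} \<subseteq> {x. 0 \<le> y \<bullet> x}"
          using c(1) U(2) W(4) by (auto simp: y_at intro!: sum_nonneg mult_nonneg_nonneg)
      qed (rule convex_cone_halfspace_ge)
      then show ?thesis using that by auto
    qed
    moreover have "y \<bullet> ?n = 1"
    proof -
      have "y \<bullet> ?n = sum c U"
        unfolding y_at by (intro sum.cong refl) (use U(2) W(3) in auto)
      then show ?thesis using c(2) by simp
    qed
    moreover have "y \<bullet> (x, 1) = 0" if "x \<in> F" for x
      unfolding y_at by (rule sum.neutral) (use that in \<open>auto simp: U_def\<close>)
    ultimately show "y \<in> dual_face M r P F"
      by (auto simp: dual_face_def dual_gorenstein_def dual_cone_def)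
  qed
  then show ?thesis by (simp add: U_def)
qed

section \<open>The inequality between the codegrees\<close>

lemma inner_height_one_convex_comb:
  fixes Z :: "'a::euclidean_space \<times> real"
  assumes "u + v = 1"
  shows "Z \<bullet> (u *\<^sub>R x + v *\<^sub>R y, 1) = u * (Z \<bullet> (x, 1)) + v * (Z \<bullet> (y, 1))"
proof -
  have "(u *\<^sub>R x + v *\<^sub>R y, 1) = u *\<^sub>R (x, 1) + v *\<^sub>R (y, 1::real)" using assms by simp
  then show ?thesis by (simp only: inner_add_right inner_scaleR_right)
qed

lemma Ints_pos_ge_1: "1 \<le> x" if "x \<in> \<int>" "0 < x" for x :: real
  using that by (auto elim!: Ints_cases)

theorem theorem3p6:
  fixes M P F :: "'a::euclidean_space set" and r :: nat
  assumes "zlattice M"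
    and "gorenstein M r P"
    and "F face_of P"
  shows "int r \<le> codeg M F + codeg (dual_lattice_ext M) (dual_face M r P F)"
proof -
  define m where "m = gorenstein_point M r P"
  obtain W where W: "finite W" "W \<subseteq> dual_lattice_ext M"
    "\<And>w. w \<in> W \<Longrightarrow> w \<bullet> (m, real r) = 1"
    "\<And>w x. w \<in> W \<Longrightarrow> x \<in> P \<Longrightarrow> 0 \<le> w \<bullet> (x, 1)"
    "\<And>y. fst y \<in> span M \<Longrightarrow> (\<And>x. x \<in> P \<Longrightarrow> 0 \<le> y \<bullet> (x, 1)) \<Longrightarrow> y \<in> nonneg_combs W"
    unfolding m_def using gorenstein_dual_cone_generators[OF assms(2)] by metis
  obtain V where V: "finite V" "V \<subseteq> M" "P = convex hull V"
    using assms(2) by (auto simp: gorenstein_def lattice_polytope_def)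
  obtain VF where VF: "VF \<subseteq> V" "F = convex hull VF"
    using face_of_convex_hull_subset[OF finite_imp_compact[OF V(1)]] assms(3) V(3) by metis
  have FP: "F \<subseteq> P" using assms(3) by (rule face_of_imp_subset)
  define U where "U = {w \<in> W. \<forall>x\<in>F. w \<bullet> (x, 1) = 0}"
  have U: "finite U" "U \<subseteq> W" using W(1) by (auto simp: U_def)
  have dual: "dual_face M r P F = convex hull U"
    unfolding U_def by (rule dual_face_eq_hull[OF FP W[unfolded m_def]])
  have finVF: "finite VF" using VF(1) V(1) by (rule finite_subset)
  obtain c where c: "\<And>v. v \<in> VF \<Longrightarrow> 0 < c v" "(\<Sum>v\<in>VF. c v *\<^sub>R v) \<in> M"
    "(\<Sum>v\<in>VF. c v) = of_int (codeg M F)"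
    unfolding VF(2)
    by (rule codeg_interior_point[OF finVF _ zlattice_zero_diff[OF assms(1)]
          zlattice_finite_bounded[OF assms(1)]])
      (use VF(1) V(2) in auto)
  obtain d where d: "\<And>w. w \<in> U \<Longrightarrow> 0 < d w" "(\<Sum>w\<in>U. d w *\<^sub>R w) \<in> dual_lattice_ext M"
    "(\<Sum>w\<in>U. d w) = of_int (codeg (dual_lattice_ext M) (dual_face M r P F))"
    unfolding dual
    by (rule codeg_interior_point[OF U(1) _ dual_lattice_ext_zero_diff
          dual_lattice_ext_finite_bounded[OF assms(1)]])
      (use U(2) W(2) in auto)
  define s where "s = codeg M F"
  define t where "t = codeg (dual_lattice_ext M) (dual_face M r P F)"
  \<comment> \<open>For \<open>F = {}\<close> this is the zero vector with \<open>s = 0\<close>, and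
    \<open>U\<close> is all of \<open>W\<close>.\<close>
  define X where "X = (\<Sum>v\<in>VF. c v *\<^sub>R v, real_of_int s)"
  define Y where "Y = (\<Sum>w\<in>U. d w *\<^sub>R w)"
  have X_eq: "X = (\<Sum>v\<in>VF. c v *\<^sub>R (v, 1))"
    using c(3) by (simp add: X_def s_def sum_prod)
  have X_at: "w \<bullet> X = (\<Sum>v\<in>VF. c v * (w \<bullet> (v, 1)))" for w
    unfolding X_eq by (simp only: inner_sum_right inner_scaleR_right)
  have Y_at: "Y \<bullet> z = (\<Sum>w\<in>U. d w * (w \<bullet> z))" for z
    unfolding Y_def by (simp add: inner_sum_left)
  have pairing: "y \<bullet> (x, real_of_int k) \<in> \<int>" if "y \<in> dual_lattice_ext M" "x \<in> M" for x y k
    using that by (cases y) (auto simp: dual_lattice_ext_def dual_lattice_def)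
  \<comment> \<open>The height function has value 1 on \<open>P\<close>, so it lies in the cone
    generated by \<open>W\<close>.\<close>
  have "(0, 1) \<in> nonneg_combs W" by (rule W(5)) (auto simp: span_zero)
  then obtain a where a: "\<And>w. w \<in> W \<Longrightarrow> 0 \<le> a w" "(0, 1) = (\<Sum>w\<in>W. a w *\<^sub>R w)"
    by (auto simp: nonneg_combs_def)
  have e_at: "(0, 1) \<bullet> z = (\<Sum>w\<in>W. a w * (w \<bullet> z))" for z
    unfolding a(2) by (simp add: inner_sum_left)
  have split: "(\<Sum>w\<in>W. f w) = (\<Sum>w\<in>W - U. f w) + (\<Sum>w\<in>U. f w)" for f :: "_ \<Rightarrow> real"
    using W(1) U(2) by (rule sum.subset_diff[rotated])

  have "real r = (\<Sum>w\<in>W. a w)"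
    using e_at[of "(m, real r)"] W(3) by simp
  moreover have "(\<Sum>w\<in>W - U. a w) \<le> of_int s"
  proof -
    have XU: "w \<bullet> X = 0" if "w \<in> U" for w
      unfolding X_at
    proof (intro sum.neutral ballI)
      fix v assume "v \<in> VF"
      then have "v \<in> F" unfolding VF(2) by (rule hull_inc)
      then show "c v * (w \<bullet> (v, 1)) = 0" using that by (simp add: U_def)
    qed
    have XW: "1 \<le> w \<bullet> X" if w: "w \<in> W - U" for w
    proof (rule Ints_pos_ge_1)
      show "w \<bullet> X \<in> \<int>" unfolding X_def by (rule pairing) (use w W(2) c(2) in auto)
      have nn: "0 \<le> c v * (w \<bullet> (v, 1))" if "v \<in> VF" for v
        using c(1)[OF that] W(4)[of w v] w that VF(1)
        by (intro mult_nonneg_nonneg) (auto simp: V(3) hull_inc subsetD less_imp_le)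
      \<comment> \<open>All coefficients \<open>c v\<close> are positive, so a zero value at
        \<open>X\<close> would make \<open>w\<close> vanish on \<open>VF\<close> and hence on
        \<open>F\<close>, putting \<open>w\<close> into \<open>U\<close>.\<close>
      have "w \<bullet> X \<noteq> 0"
      proof
        assume "w \<bullet> X = 0"
        then have "\<forall>v\<in>VF. c v * (w \<bullet> (v, 1)) = 0"
          unfolding X_at using sum_nonneg_eq_0_iff[OF finVF nn] by simp
        then have "VF \<subseteq> {x. w \<bullet> (x, 1) = 0}" using c(1) by force
        moreover have "convex {x. w \<bullet> (x, 1) = 0}"
          by (rule convexI) (simp add: inner_height_one_convex_comb del: inner_Pair)
        ultimately have "F \<subseteq> {x. w \<bullet> (x, 1) = 0}" unfolding VF(2) by (rule hull_minimal)
        then show False using w by (auto simp: U_def)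
      qed
      moreover have "0 \<le> w \<bullet> X" unfolding X_at using nn by (rule sum_nonneg)
      ultimately show "0 < w \<bullet> X" by simp
    qed
    have "(\<Sum>w\<in>W - U. a w) \<le> (\<Sum>w\<in>W - U. a w * (w \<bullet> X))"
    proof (rule sum_mono)
      fix w assume w: "w \<in> W - U"
      then have "a w * 1 \<le> a w * (w \<bullet> X)" using XW[OF w] a(1) by (intro mult_left_mono) auto
      then show "a w \<le> a w * (w \<bullet> X)" by simp
    qed
    also have "\<dots> = (\<Sum>w\<in>W. a w * (w \<bullet> X))"
      unfolding split[of "\<lambda>w. a w * (w \<bullet> X)"] using XU by simp
    also have "\<dots> = of_int s" unfolding e_at[symmetric] by (simp add: X_def)
    finally show ?thesis .
  qed
  moreover have "(\<Sum>w\<in>U. a w) \<le> of_int t"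
  proof -
    \<comment> \<open>Once \<open>Z\<close> is known to be nonnegative on \<open>P\<close>, its
      value at \<open>(m, real r)\<close>, namely \<open>t\<close> minus the sum of \<open>a\<close>
      over \<open>U\<close>, is nonnegative.\<close>
    define Z where "Z = Y - (\<Sum>w\<in>U. a w *\<^sub>R w)"
    have Z_at: "Z \<bullet> z = Y \<bullet> z - (\<Sum>w\<in>U. a w * (w \<bullet> z))" for z
      by (simp add: Z_def inner_diff_left inner_sum_left)
    have "0 \<le> Z \<bullet> (v, 1)" if v: "v \<in> V" for v
    proof -
      have vP: "v \<in> P" using v unfolding V(3) by (rule hull_inc)
      have Wv: "0 \<le> w \<bullet> (v, 1)" if "w \<in> W" for w using W(4)[OF that vP] .
      have nn: "0 \<le> d w * (w \<bullet> (v, 1))" if "w \<in> U" for w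
        using less_imp_le[OF d(1)[OF that]] Wv[OF subsetD[OF U(2) that]] by (rule mult_nonneg_nonneg)
      \<comment> \<open>\<open>Z\<close> equals \<open>Y - (0, 1)\<close> plus the part of \<open>(0, 1)\<close> carried by \<open>W - U\<close>, and \<open>Y\<close> is integral.\<close>
      show ?thesis
      proof (cases "Y \<bullet> (v, 1) = 0")
        case True
        then have "\<forall>w\<in>U. d w * (w \<bullet> (v, 1)) = 0"
          unfolding Y_at using sum_nonneg_eq_0_iff[OF U(1) nn] by simp
        then have "\<forall>w\<in>U. w \<bullet> (v, 1) = 0" using d(1) by force
        then show ?thesis unfolding Z_at True by simp
      next
        case False
        moreover have "0 \<le> Y \<bullet> (v, 1)" unfolding Y_at using nn by (rule sum_nonneg)
        moreover have "Y \<bullet> (v, 1) \<in> \<int>"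
          using pairing[OF d(2), of v 1] v V(2) by (auto simp: Y_def)
        ultimately have "1 \<le> Y \<bullet> (v, 1)" by (intro Ints_pos_ge_1) auto
        moreover have "(\<Sum>w\<in>U. a w * (w \<bullet> (v, 1))) \<le> (\<Sum>w\<in>W. a w * (w \<bullet> (v, 1)))"
          using W(1) U(2) a(1) Wv by (intro sum_mono2) auto
        moreover have "\<dots> = 1" unfolding e_at[symmetric] by simp
        ultimately show ?thesis unfolding Z_at by linarith
      qed
    qed
    then have "V \<subseteq> {x. 0 \<le> Z \<bullet> (x, 1)}" by auto
    moreover have "convex {x. 0 \<le> Z \<bullet> (x, 1)}"
      by (rule convexI) (simp add: inner_height_one_convex_comb)
    ultimately have ZP: "P \<subseteq> {x. 0 \<le> Z \<bullet> (x, 1)}" unfolding V(3) by (rule hull_minimal)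
    \<comment> \<open>The Gorenstein point is \<open>r\<close> times a point of \<open>P\<close>, so
      \<open>(m, real r)\<close> lies in the cone over \<open>P\<close>.\<close>
    have "m \<in> rel_interior (dilate r P)"
      using gorenstein_pointD(1)[OF assms(2)] by (auto simp: m_def)
    then have "m \<in> dilate r P" using rel_interior_subset by (rule subsetD[rotated])
    then obtain x where x: "x \<in> P" "m = real r *\<^sub>R x" by (auto simp: dilate_def)
    have "(m, real r) = real r *\<^sub>R (x, 1)" by (simp add: x(2))
    then have "Z \<bullet> (m, real r) = real r * (Z \<bullet> (x, 1))" by (metis inner_scaleR_right)
    then have "0 \<le> Z \<bullet> (m, real r)" using ZP x(1) by auto
    moreover have "Y \<bullet> (m, real r) = of_int t"
    proof -
      have "Y \<bullet> (m, real r) = (\<Sum>w\<in>U. d w)"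
        unfolding Y_at by (intro sum.cong refl) (use U(2) W(3) in auto)
      then show ?thesis using d(3) by (simp add: t_def)
    qed
    moreover have "(\<Sum>w\<in>U. a w * (w \<bullet> (m, real r))) = (\<Sum>w\<in>U. a w)"
      by (intro sum.cong refl) (use U(2) W(3) in auto)
    ultimately show ?thesis unfolding Z_at by simp
  qed
  ultimately have "real r \<le> of_int s + of_int t" unfolding split[of a] by linarith
  then show ?thesis unfolding s_def t_def by linarith
qed

end
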